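(* Let $d\geq 1$ and let $\mathscr{F}\subseteq[0,1]^d$ be a non-empty closed set having every portion of positive cone width. Let $\mathscr{A}\subseteq(0,1)^d$ be an analytic set such that $\mathscr{A}\cap\mathscr{F}$ is relatively residual in $\mathscr{F}$. Then there exist a $1$-Lipschitz curve $\gamma\colon[0,1]\to(0,1)^d$ and sets $E\subseteq F\subseteq[0,1]$ such that: (i) $F$ is non-empty, closed and has every portion of positive measure; (ii) $E$ is residual in $F$; (iii) $\gamma$ is differentiable at every $t\in E$ with $\|\gamma'(t)\|=1$; (iv) for every $t\in E$, $\lim_{\delta\to 0}\operatorname{osc}(\gamma',[t-\delta,t+\delta])=0$; (v) $\gamma(E)\subseteq\mathscr{A}$.
   Context: A curve (Lipschitz curve) is a Lipschitz map $\gamma\colon I\to\mathbb{R}^d$, $I$ a closed interval, whose derivative is bounded away from zero in norm almost everywhere; "$1$-Lipschitz" means Lipschitz constant at most $1$. A set $\mathscr{F}\subseteq\mathbb{R}^d$ has every portion of positive cone width if for every open $U\subseteq\mathbb{R}^d$ with $U\cap\mathscr{F}\neq\emptyset$ there is a $C^1$-smooth curve $\nu_U\colon[0,1]\to\mathbb{R}^d$ with nowhere zero derivative such that $\nu_U^{-1}(U\cap\mathscr{F})$ has positive Lebesgue measure. A set $F\subseteq\mathbb{R}$ has every portion of positive measure if for every open $U\subseteq\mathbb{R}$ with $U\cap F\neq\emptyset$, $U\cap F$ has positive Lebesgue measure. For an $L^\infty$ map $\phi\colon I\to\mathbb{R}^d$ and $U\subseteq I$, $\operatorname{osc}(\phi,U)=\operatorname{ess\,sup}\{\|\phi(s)-\phi(t)\|\colon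 s,t\in U\}$. *)

theory Defs
  imports "HOL-Analysis.Analysis"
begin

definition every_portion_pos_cone_width :: "'a::euclidean_space set \<Rightarrow> bool" where
  "every_portion_pos_cone_width S \<longleftrightarrow>
     (\<forall>U. open U \<and> U \<inter> S \<noteq> {} \<longrightarrow>
        (\<exists>(\<nu>::real \<Rightarrow> 'a) \<nu>'.
            (\<forall>t\<in>{0..1}. (\<nu> has_vector_derivative \<nu>' t) (at t within {0..1}))
          \<and> continuous_on {0..1} \<nu>'
          \<and> (\<forall>t\<in>{0..1}. \<nu>' t \<noteq> 0)
          \<and> emeasure lebesgue {t\<in>{0..1}. \<nu> t \<in> U \<inter> S} > 0))"

definition every_portion_pos_measure :: "real set \<Rightarrow> bool" where
  "every_portion_pos_measure F \<longleftrightarrow>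
     (\<forall>U. open U \<and> U \<inter> F \<noteq> {} \<longrightarrow> emeasure lebesgue (U \<inter> F) > 0)"

definition nowhere_dense_in :: "'a::topological_space set \<Rightarrow> 'a set \<Rightarrow> bool" where
  "nowhere_dense_in S N \<longleftrightarrow>
     N \<subseteq> S \<and> (top_of_set S) interior_of ((top_of_set S) closure_of N) = {}"

definition meager_in :: "'a::topological_space set \<Rightarrow> 'a set \<Rightarrow> bool" where
  "meager_in S M \<longleftrightarrow> M \<subseteq> S \<and>
     (\<exists>\<N>. countable \<N> \<and> (\<forall>N\<in>\<N>. nowhere_dense_in S N) \<and> M \<subseteq> \<Union>\<N>)"

definition residual_in :: "'a::topological_space set \<Rightarrow> 'a set \<Rightarrow> bool" where
  "residual_in S E \<longleftrightarrow> E \<subseteq> S \<and> meager_in S (S - E)"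

text \<open>Analytic sets: empty, or a continuous image of the Baire space nat^nat
  (with the product topology of discrete nat).\<close>
definition analytic_set :: "'a::topological_space set \<Rightarrow> bool" where
  "analytic_set A \<longleftrightarrow> A = {} \<or>
     (\<exists>f :: (nat \<Rightarrow> nat) \<Rightarrow> 'a. continuous_on UNIV f \<and> range f = A)"

definition osc :: "(real \<Rightarrow> 'a::real_normed_vector) \<Rightarrow> real set \<Rightarrow> ereal" where
  "osc \<phi> U = Inf {c. AE p in (lebesgue_on U \<Otimes>\<^sub>M lebesgue_on U).
                      ereal (norm (\<phi> (fst p) - \<phi> (snd p))) \<le> c}"

definition lipschitz_curve :: "real \<Rightarrow> real \<Rightarrow> (real \<Rightarrow> 'a::euclidean_space) \<Rightarrow> bool" where
  "lipschitz_curve a b \<gamma> \<longleftrightarrow> a \<le> b \<and> (\<exists>L. L-lipschitz_on {a..b} \<gamma>) \<and>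
     (\<exists>c>0. AE t in lebesgue_on {a..b}.
        \<exists>v. (\<gamma> has_vector_derivative v) (at t within {a..b}) \<and> norm v \<ge> c)"

end

theory Submission
  imports Defs
begin

text \<open>
  By Baire's theorem the residual set contains \<open>\<F> \<inter> \<Inter>n. G n\<close> for a decreasing sequence of open sets that are
  dense in \<open>\<F>\<close> and lie in the open unit cube. Covering the unit sphere by finitely
  many small balls shows that every portion of \<open>\<F>\<close> has a subportion with a stable direction: a
  direction \<open>v\<close> such that each still smaller portion is met, in positive measure, by an arc pointing almost
  along \<open>v\<close>, and these directions can be refined with an error tending to zero.

  The curve is a limit of modifications. At each step one picks a point \<open>x\<close> of the set of times that an earlier
  arc spends in \<open>\<F>\<close>, and in a tiny interval around \<open>x\<close> grafts a much shorter arc that meets \<open>\<F>\<close> inside the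
  next \<open>G n\<close>; affine corrections reconnect it to the old curve. All arcs have speed slightly below 1, which
  leaves room for the corrections, and the velocities inside a grafted arc stay within a small ball forever.
  The intervals are so short that every earlier set of times keeps positive measure, and \<open>F\<close> is the measure
  support of what remains. The points of \<open>F\<close> lying in infinitely many grafted arcs form \<open>E\<close>.
\<close>

subsection \<open>Lebesgue support of a set of reals\<close>

text \<open>Different portions may offer arcs in unrelated directions, so a careless graft would
  destroy the derivative and the small oscillation gained before. Stability removes this obstacle:
  inside its own region an arc can be refined while the direction stays in a small ball, and these
  balls are nested along nested arcs. Two demands compete: surviving times must keep measure, yet
  grafts must be dense among them. Every step therefore serves one pair of an earlier arc
  \<open>p\<close> and a basic open set \<open>B i\<close>, read off from the step number by
  \<open>prod_decode\<close>. A pair is never served before its arc exists, and every pair is served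
  once. Measure and category live on disjoint sets. A core time that survives lies in only finitely
  many arcs; such times give \<open>F\<close> its measure. A time in \<open>E\<close> lies in
  infinitely many arcs, and only this places its image in every \<open>G n\<close>, while closedness
  places it in the given closed set.\<close>

definition lebesgue_support :: "real set \<Rightarrow> real set" where
  "lebesgue_support T = {t. \<forall>U. open U \<and> t \<in> U \<longrightarrow> 0 < emeasure lebesgue (U \<inter> T)}"

lemma closed_lebesgue_support: "closed (lebesgue_support T)"
proof -
  have "- lebesgue_support T = \<Union>{U. open U \<and> emeasure lebesgue (U \<inter> T) = 0}"
    by (auto simp: lebesgue_support_def)
  then show ?thesis
    by (metis (mono_tags, lifting) closed_def mem_Collect_eq open_Union)
qed

text \<open>The points outside the support are covered by open sets meeting \<open>T\<close> in
  measure zero; Lindelof reduces them to countably many.\<close>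

lemma null_diff_lebesgue_support:
  assumes T: "T \<in> sets lebesgue"
  shows "T - lebesgue_support T \<in> null_sets lebesgue"
proof -
  define \<U> where "\<U> = {U. open U \<and> emeasure lebesgue (U \<inter> T) = 0}"
  obtain \<V> where \<V>: "\<V> \<subseteq> \<U>" "countable \<V>" "\<Union>\<V> = \<Union>\<U>"
    using Lindelof[of \<U>] by (auto simp: \<U>_def)
  have "T - lebesgue_support T = (\<Union>U\<in>\<V>. U \<inter> T)"
    using \<V>(3) by (auto simp: lebesgue_support_def \<U>_def)
  moreover have "(\<Union>U\<in>\<V>. U \<inter> T) \<in> null_sets lebesgue"
  proof (rule null_sets_UN')
    fix U assume "U \<in> \<V>"
    then have "open U" "emeasure lebesgue (U \<inter> T) = 0"
      using \<V>(1) by (auto simp: \<U>_def)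
    moreover have "U \<in> sets lebesgue"
      using \<open>open U\<close> by (simp add: borel_open)
    ultimately show "U \<inter> T \<in> null_sets lebesgue"
      using T by (metis null_setsI sets.Int)
  qed (use \<V> in auto)
  ultimately show ?thesis by simp
qed

lemma emeasure_Int_lebesgue_support:
  assumes T: "T \<in> sets lebesgue" and "U \<in> sets lebesgue"
  shows "emeasure lebesgue (U \<inter> T \<inter> lebesgue_support T) = emeasure lebesgue (U \<inter> T)"
proof -
  have *: "U \<inter> T \<inter> lebesgue_support T = (U \<inter> T) - (T - lebesgue_support T)" by auto
  show ?thesis
    unfolding * using assms null_diff_lebesgue_support[OF T]
    by (intro emeasure_Diff_null_set) auto
qed

lemma every_portion_pos_measure_lebesgue_support:
  assumes T: "T \<in> sets lebesgue"
  shows "every_portion_pos_measure (lebesgue_support T)"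
  unfolding every_portion_pos_measure_def
proof (intro allI impI, elim conjE)
  fix U :: "real set" assume U: "open U" "U \<inter> lebesgue_support T \<noteq> {}"
  then have "0 < emeasure lebesgue (U \<inter> T)"
    by (auto simp: lebesgue_support_def)
  also have "\<dots> = emeasure lebesgue (U \<inter> T \<inter> lebesgue_support T)"
    using T U by (simp add: emeasure_Int_lebesgue_support borel_open)
  also have "\<dots> \<le> emeasure lebesgue (U \<inter> lebesgue_support T)"
    using U T closed_lebesgue_support[of T]
    by (intro emeasure_mono) (auto simp: borel_open)
  finally show "0 < emeasure lebesgue (U \<inter> lebesgue_support T)" .
qed

lemma measure_compact_pos_iff:
  fixes K :: "real set"
  shows "compact K \<Longrightarrow> 0 < measure lebesgue K \<longleftrightarrow> 0 < emeasure lebesgue K"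
  by (metis emeasure_eq_measure2 ennreal_less_zero_iff fmeasurableD2 lmeasurable_compact)

lemma exists_compact_subset_pos_measure:
  fixes T :: "real set"
  assumes pos: "0 < emeasure lebesgue T" and bdd: "bounded T"
  obtains K where "compact K" "K \<subseteq> T" "0 < measure lebesgue K"
proof -
  have T: "T \<in> sets lebesgue"
    using pos emeasure_notin_sets by fastforce
  define e where "e = measure lebesgue T / 2"
  have "emeasure lebesgue T = ennreal (2 * e)"
    using T bdd by (simp add: e_def emeasure_eq_measure2 bounded_set_imp_lmeasurable)
  then have e: "0 < e" "ennreal e < emeasure lebesgue T"
    using pos by (auto simp: ennreal_less_zero_iff ennreal_less_iff)
  obtain K where K: "closed K" "K \<subseteq> T" "T - K \<in> lmeasurable" "emeasure lebesgue (T - K) < ennreal e"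
    using sets_lebesgue_inner_closed[OF T e(1)] by blast
  have "compact K"
    using K bdd by (meson bounded_subset compact_eq_bounded_closed)
  have "emeasure lebesgue T = emeasure lebesgue K + emeasure lebesgue (T - K)"
    using K T by (metis Diff_partition Diff_disjoint plus_emeasure fmeasurableD \<open>compact K\<close> lmeasurable_compact)
  then have "emeasure lebesgue K \<noteq> 0"
    using K(4) e(2) by auto
  then show thesis
    using that K \<open>compact K\<close> by (metis measure_compact_pos_iff not_gr_zero)
qed

subsection \<open>Stable directions\<close>

text \<open>A small Lipschitz constant of the difference with \<open>t\<close> times
  \<open>w\<close> says that the velocity is close to \<open>w\<close> without naming a derivative.
  This form survives gluing and pointwise limits. Keeping \<open>P\<close> off the endpoints places
  its times in the open arc.\<close>

definition short_arc :: "'a::euclidean_space set \<Rightarrow> 'a set \<Rightarrow> 'a \<Rightarrow> bool" where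
  "short_arc S U w \<longleftrightarrow> (\<forall>\<epsilon>>0. \<forall>\<delta>>0. \<exists>l \<nu> P. 0 < l \<and> l \<le> \<delta> \<and>
     (\<forall>t\<in>{0..l}. \<nu> differentiable (at t within {0..l})) \<and>
     \<epsilon>-lipschitz_on {0..l} (\<lambda>t. \<nu> t - t *\<^sub>R w) \<and>
     compact P \<and> P \<subseteq> {0<..<l} \<and> 0 < measure lebesgue P \<and> \<nu> ` P \<subseteq> U \<inter> S)"

text \<open>Reparametrisation makes the speed free, so only the direction matters; the speed chosen
  later is \<open>1 - 2 * \<epsilon>\<close>.\<close>

definition admits_direction :: "'a::euclidean_space set \<Rightarrow> 'a set \<Rightarrow> 'a \<Rightarrow> bool" where
  "admits_direction S U u \<longleftrightarrow> norm u = 1 \<and> (\<forall>c>0. short_arc S U (c *\<^sub>R u))"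

text \<open>The direction may vary with the subportion by up to \<open>\<epsilon>\<close>, because a
  finite cover by balls locates directions only up to their radius.\<close>

definition stable_direction :: "'a::euclidean_space set \<Rightarrow> 'a set \<Rightarrow> 'a \<Rightarrow> real \<Rightarrow> bool" where
  "stable_direction S V v \<epsilon> \<longleftrightarrow> norm v = 1 \<and> open V \<and> V \<inter> S \<noteq> {} \<and>
     (\<forall>W. open W \<and> W \<subseteq> V \<and> W \<inter> S \<noteq> {} \<longrightarrow> (\<exists>u. admits_direction S W u \<and> norm (u - v) \<le> \<epsilon>))"

lemma admits_direction_mono:
  assumes "admits_direction S W u" "W \<subseteq> V"
  shows "admits_direction S V u"
proof -
  have "short_arc S V w" if w: "short_arc S W w" for w
    unfolding short_arc_def
  proof (intro allI impI)
    fix \<epsilon> \<delta> :: real assume "0 < \<epsilon>" "0 < \<delta>"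
    then obtain l \<nu> P where "0 < l \<and> l \<le> \<delta> \<and>
       (\<forall>t\<in>{0..l}. \<nu> differentiable (at t within {0..l})) \<and>
       \<epsilon>-lipschitz_on {0..l} (\<lambda>t. \<nu> t - t *\<^sub>R w) \<and>
       compact P \<and> P \<subseteq> {0<..<l} \<and> 0 < measure lebesgue P \<and> \<nu> ` P \<subseteq> W \<inter> S"
      using w unfolding short_arc_def by presburger
    moreover from this have "\<nu> ` P \<subseteq> V \<inter> S"
      using assms(2) by blast
    ultimately show "\<exists>l \<nu> P. 0 < l \<and> l \<le> \<delta> \<and>
       (\<forall>t\<in>{0..l}. \<nu> differentiable (at t within {0..l})) \<and>
       \<epsilon>-lipschitz_on {0..l} (\<lambda>t. \<nu> t - t *\<^sub>R w) \<and>
       compact P \<and> P \<subseteq> {0<..<l} \<and> 0 < measure lebesgue P \<and> \<nu> ` P \<subseteq> V \<inter> S"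
      by blast
  qed
  then show ?thesis
    using assms(1) by (simp add: admits_direction_def)
qed

text \<open>Either the ball about \<open>c\<close> serves all subportions, or some subportion
  \<open>W\<close> admits no direction from it. By monotonicity no portion inside \<open>W\<close>
  does either, so within \<open>W\<close> this ball can be removed from \<open>D\<close> and the
  cover loses a member.\<close>

lemma exists_stable_direction_in_finite_cover:
  assumes "finite C" and "open V" "V \<inter> S \<noteq> {}"
    and "\<forall>W. open W \<and> W \<subseteq> V \<and> W \<inter> S \<noteq> {} \<longrightarrow> (\<exists>u\<in>D. admits_direction S W u)"
    and "D \<subseteq> (\<Union>c\<in>C. cball c \<epsilon>)"
  shows "\<exists>c\<in>C. \<exists>V'. open V' \<and> V' \<subseteq> V \<and> V' \<inter> S \<noteq> {} \<and>
     (\<forall>W. open W \<and> W \<subseteq> V' \<and> W \<inter> S \<noteq> {} \<longrightarrow> (\<exists>u\<in>D \<inter> cball c \<epsilon>. admits_direction S W u))"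
  using assms
proof (induction C arbitrary: V D rule: finite_induct)
  case empty
  then show ?case by fastforce
next
  case (insert c C)
  show ?case
  proof (cases "\<forall>W. open W \<and> W \<subseteq> V \<and> W \<inter> S \<noteq> {} \<longrightarrow> (\<exists>u\<in>D \<inter> cball c \<epsilon>. admits_direction S W u)")
    case True
    then show ?thesis using insert.prems by blast
  next
    case False
    then obtain W where W: "open W" "W \<subseteq> V" "W \<inter> S \<noteq> {}"
      and none: "\<And>u. u \<in> D \<inter> cball c \<epsilon> \<Longrightarrow> \<not> admits_direction S W u"
      by blast
    \<comment> \<open>\<open>c0\<close> is a second name for the fixed \<open>c\<close>, which the
      bound variable \<open>c\<close> hides here.\<close>
    have "\<exists>c\<in>C. \<exists>V'. open V' \<and> V' \<subseteq> W \<and> V' \<inter> S \<noteq> {} \<and>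
       (\<forall>X. open X \<and> X \<subseteq> V' \<and> X \<inter> S \<noteq> {} \<longrightarrow>
          (\<exists>u\<in>(D - cball c0 \<epsilon>) \<inter> cball c \<epsilon>. admits_direction S X u))" if "c0 = c" for c0
    proof (rule insert.IH)
      show "open W" "W \<inter> S \<noteq> {}" by (fact W)+
      show "D - cball c0 \<epsilon> \<subseteq> (\<Union>c\<in>C. cball c \<epsilon>)"
        using insert.prems(4) that by auto
      show "\<forall>X. open X \<and> X \<subseteq> W \<and> X \<inter> S \<noteq> {} \<longrightarrow> (\<exists>u\<in>D - cball c0 \<epsilon>. admits_direction S X u)"
      proof (intro allI impI, elim conjE)
        fix X assume X: "open X" "X \<subseteq> W" "X \<inter> S \<noteq> {}"
        then obtain u where "u \<in> D" "admits_direction S X u"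
          using insert.prems(3) W by (meson order_trans)
        then show "\<exists>u\<in>D - cball c0 \<epsilon>. admits_direction S X u"
          using none admits_direction_mono[OF _ X(2)] that by blast
      qed
    qed
    then obtain c' V' where "c' \<in> C" "open V'" "V' \<subseteq> W" "V' \<inter> S \<noteq> {}"
      and "\<And>X. open X \<Longrightarrow> X \<subseteq> V' \<Longrightarrow> X \<inter> S \<noteq> {} \<Longrightarrow>
          \<exists>u\<in>(D - cball c \<epsilon>) \<inter> cball c' \<epsilon>. admits_direction S X u"
      by metis
    moreover from this have "V' \<subseteq> V" using W by blast
    ultimately show ?thesis
      by (intro bexI[of _ c'] exI[of _ V']) blast+
  qed
qed

text \<open>\<open>D\<close> restricts the admissible directions. Later it is a ball about the
  direction of the host arc, and the extra witness \<open>u\<close> then bounds how far the new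
  stable direction can be from the old one.\<close>

lemma exists_stable_direction:
  fixes S :: "'a::euclidean_space set"
  assumes "0 < \<epsilon>" and "open V" "V \<inter> S \<noteq> {}"
    and ex: "\<forall>W. open W \<and> W \<subseteq> V \<and> W \<inter> S \<noteq> {} \<longrightarrow> (\<exists>u\<in>D. admits_direction S W u)"
  obtains v V' u where "V' \<subseteq> V" "stable_direction S V' v \<epsilon>" "u \<in> D" "norm (u - v) \<le> \<epsilon>"
proof -
  obtain C where C: "finite C" "C \<subseteq> sphere (0::'a) 1" "sphere 0 1 \<subseteq> (\<Union>c\<in>C. ball c \<epsilon>)"
  proof (rule compactE_image[OF compact_sphere])
    show "sphere (0::'a) 1 \<subseteq> (\<Union>c\<in>sphere 0 1. ball c \<epsilon>)"
      using \<open>0 < \<epsilon>\<close> by force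
  qed auto
  let ?D = "D \<inter> sphere 0 1"
  have ex': "\<forall>W. open W \<and> W \<subseteq> V \<and> W \<inter> S \<noteq> {} \<longrightarrow> (\<exists>u\<in>?D. admits_direction S W u)"
    using ex by (metis Int_iff admits_direction_def mem_sphere_0)
  have cov: "?D \<subseteq> (\<Union>c\<in>C. cball c \<epsilon>)"
    using C(3) ball_subset_cball by blast
  obtain c V' where cV: "c \<in> C" "open V'" "V' \<subseteq> V" "V' \<inter> S \<noteq> {}"
    and st: "\<forall>W. open W \<and> W \<subseteq> V' \<and> W \<inter> S \<noteq> {} \<longrightarrow> (\<exists>u\<in>?D \<inter> cball c \<epsilon>. admits_direction S W u)"
    using exists_stable_direction_in_finite_cover[OF C(1) assms(2,3) ex' cov]
    by (elim bexE exE conjE) (rule that)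
  have "norm c = 1"
    using cV(1) C(2) by auto
  have near: "\<exists>u\<in>D. admits_direction S W u \<and> norm (u - c) \<le> \<epsilon>"
    if "open W" "W \<subseteq> V'" "W \<inter> S \<noteq> {}" for W
    using st that by (force simp: dist_norm norm_minus_commute)
  obtain u where "u \<in> D" "norm (u - c) \<le> \<epsilon>"
    using near[of V'] cV by blast
  moreover have "stable_direction S V' c \<epsilon>"
    using near cV \<open>norm c = 1\<close> unfolding stable_direction_def by blast
  ultimately show thesis
    using that cV(3) by blast
qed

text \<open>Zooming in at a time \<open>t0\<close> makes a C^1 curve nearly straight with velocity
  \<open>\<nu>' t0\<close>. If \<open>t0\<close> is in the support of the set of good times, every
  zoomed piece still has good times of positive measure.\<close>

lemma portion_admits_direction:
  fixes S :: "'a::euclidean_space set"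
  assumes S: "every_portion_pos_cone_width S" and U: "open U" "U \<inter> S \<noteq> {}"
  obtains u where "admits_direction S U u"
proof -
  obtain \<nu> :: "real \<Rightarrow> 'a" and \<nu>' where
    \<nu>: "\<And>t. t \<in> {0..1} \<Longrightarrow> (\<nu> has_vector_derivative \<nu>' t) (at t within {0..1})"
    and cont: "continuous_on {0..1} \<nu>'" and nz: "\<And>t. t \<in> {0..1} \<Longrightarrow> \<nu>' t \<noteq> 0"
    and pos: "0 < emeasure lebesgue {t\<in>{0..1}. \<nu> t \<in> U \<inter> S}"
    using S[unfolded every_portion_pos_cone_width_def, rule_format, OF conjI[OF U]] by blast
  define T where "T = {t\<in>{0..1}. \<nu> t \<in> U \<inter> S}"
  have "T \<in> sets lebesgue"
    using pos emeasure_notin_sets unfolding T_def by fastforce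
  moreover have "{0, 1} \<in> null_sets lebesgue"
    using negligible_finite[of "{0, 1::real}"] by (simp add: negligible_iff_null_sets)
  ultimately have "emeasure lebesgue (T - {0, 1}) = emeasure lebesgue T"
    by (metis emeasure_Diff_null_set)
  then have "0 < emeasure lebesgue (T - {0, 1})"
    using pos by (simp add: T_def)
  moreover have "bounded (T - {0, 1})"
    by (rule bounded_subset[of "{0..1::real}"]) (auto simp: T_def)
  ultimately obtain K where K: "compact K" "K \<subseteq> T - {0, 1}" "0 < measure lebesgue K"
    by (rule exists_compact_subset_pos_measure)
  have K_sets: "K \<in> sets lebesgue"
    using K(1) lmeasurable_compact by blast
  have "0 < emeasure lebesgue (UNIV \<inter> K \<inter> lebesgue_support K)"
    using K by (subst emeasure_Int_lebesgue_support) (auto simp: K_sets measure_compact_pos_iff)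
  then obtain t0 where t0: "t0 \<in> K" "t0 \<in> lebesgue_support K"
    by (metis Int_iff emeasure_empty equals0I less_irrefl)
  have t01: "0 < t0" "t0 < 1"
    using t0 K(2) by (auto simp: T_def order_less_le)
  define n where "n = norm (\<nu>' t0)"
  have n: "0 < n"
    using nz[of t0] t01 by (simp add: n_def)
  have "short_arc S U (c *\<^sub>R (\<nu>' t0 /\<^sub>R n))" if "0 < c" for c
    unfolding short_arc_def
  proof (intro allI impI)
    fix \<epsilon> \<delta> :: real assume \<epsilon>: "0 < \<epsilon>" and \<delta>: "0 < \<delta>"
    define a where "a = c / n"
    have a: "0 < a" using n that by (simp add: a_def)
    obtain d where d: "0 < d" "\<And>t. t \<in> {0..1} \<Longrightarrow> dist t t0 < d \<Longrightarrow> dist (\<nu>' t) (\<nu>' t0) < \<epsilon> / a"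
      using cont t01 \<epsilon> a unfolding continuous_on_iff
      by (metis atLeastAtMost_iff divide_pos_pos less_eq_real_def)
    \<comment> \<open>\<open>\<phi>\<close> below runs over \<open>{t0 - r..t0 + r}\<close> in time
      \<open>l = 2 * r / a\<close>. The factor \<open>a = c / n\<close> turns the speed
      \<open>n\<close> at \<open>t0\<close> into \<open>c\<close>, and the last entry of the minimum
      gives \<open>l \<le> \<delta>\<close>.\<close>
    define r where "r = Min {d / 2, t0, 1 - t0, a * \<delta> / 2}"
    have r: "0 < r" "r < d" "r \<le> t0" "r \<le> 1 - t0" "2 * r \<le> a * \<delta>"
      using d t01 a \<delta> by (auto simp: r_def min_def)
    define l where "l = 2 * r / a"
    have l: "0 < l" "l \<le> \<delta>" "a * l = 2 * r"
      using r a by (auto simp: l_def field_simps)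
    define \<phi> where "\<phi> s = t0 - r + a * s" for s
    have \<phi>: "\<phi> s \<in> {0..1}" "dist (\<phi> s) t0 < d" if "s \<in> {0..l}" for s
    proof -
      have "a * s \<le> 2 * r" "0 \<le> a * s"
        using that l a by (metis atLeastAtMost_iff mult_le_cancel_left_pos, simp)
      then show "\<phi> s \<in> {0..1}" "dist (\<phi> s) t0 < d"
        using r by (auto simp: \<phi>_def dist_real_def)
    qed
    have der: "((\<lambda>s. \<nu> (\<phi> s)) has_vector_derivative a *\<^sub>R \<nu>' (\<phi> s)) (at s within {0..l})" if s: "s \<in> {0..l}" for s
    proof -
      have "(\<phi> has_vector_derivative a) (at s within {0..l})"
        unfolding \<phi>_def by (auto intro!: derivative_eq_intros)
      moreover have "(\<nu> has_vector_derivative \<nu>' (\<phi> s)) (at (\<phi> s) within \<phi> ` {0..l})"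
        using \<phi>(1) s by (intro has_vector_derivative_within_subset[OF \<nu>]) auto
      ultimately show ?thesis
        using vector_diff_chain_within by (force simp: o_def)
    qed
    let ?w = "c *\<^sub>R (\<nu>' t0 /\<^sub>R n)"
    have w: "?w = a *\<^sub>R \<nu>' t0" by (simp add: a_def divide_inverse)
    have lip: "\<epsilon>-lipschitz_on {0..l} (\<lambda>s. \<nu> (\<phi> s) - s *\<^sub>R ?w)"
    proof (rule bounded_derivative_imp_lipschitz)
      fix s assume s: "s \<in> {0..l}"
      show "((\<lambda>s. \<nu> (\<phi> s) - s *\<^sub>R ?w) has_derivative (\<lambda>h. h *\<^sub>R (a *\<^sub>R \<nu>' (\<phi> s) - ?w))) (at s within {0..l})"
        using der[OF s] unfolding has_vector_derivative_def
        by (auto intro!: derivative_eq_intros simp: scaleR_diff_right)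
      have "norm (a *\<^sub>R \<nu>' (\<phi> s) - ?w) = a * norm (\<nu>' (\<phi> s) - \<nu>' t0)"
        unfolding w scaleR_diff_right[symmetric] using a by simp
      also have "\<dots> \<le> a * (\<epsilon> / a)"
        using d(2)[OF \<phi>[OF s]] a by (intro mult_left_mono) (auto simp: dist_norm)
      finally have "norm (a *\<^sub>R \<nu>' (\<phi> s) - ?w) \<le> \<epsilon>" using a by simp
      then show "onorm (\<lambda>h. h *\<^sub>R (a *\<^sub>R \<nu>' (\<phi> s) - ?w)) \<le> \<epsilon>"
        by (intro onorm_le) (metis mult.commute mult_left_mono norm_ge_zero norm_scaleR real_norm_def)
    qed (use \<epsilon> in auto)
    \<comment> \<open>Half the radius keeps \<open>P\<close> away from \<open>0\<close> and
      \<open>l\<close>; the affine map defining \<open>P\<close> is the inverse of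
      \<open>\<phi>\<close>.\<close>
    define Q where "Q = K \<inter> {t0 - r / 2..t0 + r / 2}"
    define P where "P = (\<lambda>t. (1 / a) *\<^sub>R t + (r - t0) / a) ` Q"
    have "compact Q" using K(1) by (auto simp: Q_def)
    then have "compact P"
      unfolding P_def by (intro compact_continuous_image continuous_intros) auto
    have "0 < emeasure lebesgue ({t0 - r / 2<..<t0 + r / 2} \<inter> K)"
      using t0(2) r(1) by (auto simp: lebesgue_support_def)
    also have "\<dots> \<le> emeasure lebesgue Q"
      using fmeasurableD[OF lmeasurable_compact[OF \<open>compact Q\<close>]]
      by (intro emeasure_mono) (auto simp: Q_def)
    finally have "0 < emeasure lebesgue P"
      unfolding P_def using a by (subst emeasure_lebesgue_affine) (auto simp: ennreal_zero_less_mult_iff)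
    then have "0 < measure lebesgue P"
      using \<open>compact P\<close> by (simp add: measure_compact_pos_iff)
    moreover have "P \<subseteq> {0<..<l}"
    proof
      fix s assume "s \<in> P"
      then obtain t where t: "t \<in> Q" and "s = t / a + (r - t0) / a"
        by (auto simp: P_def)
      then have s: "s = (t + r - t0) / a"
        by (simp add: add_divide_distrib diff_divide_distrib)
      have "0 < t + r - t0" "t + r - t0 < 2 * r"
        using t r by (auto simp: Q_def)
      then show "s \<in> {0<..<l}"
        unfolding s l_def using a by (simp add: divide_strict_right_mono)
    qed
    moreover have "(\<lambda>s. \<nu> (\<phi> s)) ` P \<subseteq> U \<inter> S"
      using a K(2) by (auto simp: P_def Q_def \<phi>_def T_def field_simps)
    moreover have "(\<lambda>s. \<nu> (\<phi> s)) differentiable (at s within {0..l})" if "s \<in> {0..l}" for s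
      using der[OF that] by (rule differentiableI_vector)
    ultimately show "\<exists>l \<nu> P. 0 < l \<and> l \<le> \<delta> \<and>
       (\<forall>t\<in>{0..l}. \<nu> differentiable (at t within {0..l})) \<and>
       \<epsilon>-lipschitz_on {0..l} (\<lambda>t. \<nu> t - t *\<^sub>R ?w) \<and>
       compact P \<and> P \<subseteq> {0<..<l} \<and> 0 < measure lebesgue P \<and> \<nu> ` P \<subseteq> U \<inter> S"
      using l lip \<open>compact P\<close> by blast
  qed
  moreover have "norm (\<nu>' t0 /\<^sub>R n) = 1"
    using n by (simp add: n_def)
  ultimately show thesis
    using that unfolding admits_direction_def by blast
qed

subsection \<open>Oscillation, derivatives and Lipschitz bounds\<close>

lemma osc_le:
  assumes U: "U \<in> lmeasurable" and ae: "AE s in lebesgue_on U. norm (\<phi> s - v) \<le> R"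
  shows "osc \<phi> U \<le> ereal (2 * R)"
proof -
  let ?M = "lebesgue_on U"
  interpret finite_measure ?M
    using U by (rule finite_measure_lebesgue_on)
  interpret pair_sigma_finite ?M ?M ..
  \<comment> \<open>The exceptional set of \<open>\<phi>\<close> itself may fail to be measurable,
    so the product argument runs with a measurable null superset.\<close>
  obtain N where N: "{s \<in> space ?M. \<not> norm (\<phi> s - v) \<le> R} \<subseteq> N" "N \<in> null_sets ?M"
    using ae by (auto elim!: AE_E simp: null_sets_def)
  have "AE p in ?M \<Otimes>\<^sub>M ?M. fst p \<notin> N \<and> snd p \<notin> N"
  proof (rule AE_pair_measure)
    have "{x \<in> space (?M \<Otimes>\<^sub>M ?M). fst x \<notin> N \<and> snd x \<notin> N} = (space ?M - N) \<times> (space ?M - N)"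
      by (auto simp: space_pair_measure)
    then show "{x \<in> space (?M \<Otimes>\<^sub>M ?M). fst x \<notin> N \<and> snd x \<notin> N} \<in> sets (?M \<Otimes>\<^sub>M ?M)"
      using N(2) by auto
    show "AE x in ?M. AE y in ?M. fst (x, y) \<notin> N \<and> snd (x, y) \<notin> N"
      using AE_not_in[OF N(2)] by auto
  qed
  then have "AE p in ?M \<Otimes>\<^sub>M ?M. ereal (norm (\<phi> (fst p) - \<phi> (snd p))) \<le> ereal (2 * R)"
  proof (rule AE_mp, intro AE_I2 impI)
    fix p assume p: "p \<in> space (?M \<Otimes>\<^sub>M ?M)" "fst p \<notin> N \<and> snd p \<notin> N"
    then have "norm (\<phi> (fst p) - v) \<le> R" "norm (\<phi> (snd p) - v) \<le> R"
      using N(1) by (auto simp: space_pair_measure)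
    then show "ereal (norm (\<phi> (fst p) - \<phi> (snd p))) \<le> ereal (2 * R)"
      by simp norm
  qed
  then show ?thesis
    unfolding osc_def by (intro Inf_lower) auto
qed

text \<open>\<open>osc\<close> is an infimum over all extended reals. On a null set even negative
  bounds would hold almost everywhere; positive measure of the square excludes them.\<close>

lemma osc_nonneg:
  assumes "U \<in> lmeasurable" and U: "0 < emeasure lebesgue U"
  shows "0 \<le> osc \<phi> U"
  unfolding osc_def
proof (rule Inf_greatest, rule ccontr)
  fix c :: ereal
  let ?M = "lebesgue_on U"
  assume c: "c \<in> {c. AE p in ?M \<Otimes>\<^sub>M ?M. ereal (norm (\<phi> (fst p) - \<phi> (snd p))) \<le> c}" "\<not> 0 \<le> c"
  have Us: "U \<in> sets lebesgue"
    using assms(1) by auto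
  interpret finite_measure ?M
    using assms(1) by (rule finite_measure_lebesgue_on)
  have "\<not> ereal (norm x) \<le> c" for x :: 'a
    using c(2) by (metis ereal_less_eq(5) norm_ge_zero order_trans)
  then have "AE p in ?M \<Otimes>\<^sub>M ?M. False"
    using c(1) by simp
  then have "emeasure (?M \<Otimes>\<^sub>M ?M) (space ?M \<times> space ?M) = 0"
    by (subst (asm) AE_iff_measurable[OF _ refl]) (auto simp: space_pair_measure)
  then have "emeasure lebesgue U * emeasure lebesgue U = 0"
    using Us by (subst (asm) emeasure_pair_measure_Times) (auto simp: emeasure_restrict_space)
  then show False
    using U by auto
qed

text \<open>The derivative is later taken within the whole parameter interval while the drift is
  known on one arc only. Forward difference quotients that stay in \<open>{a..b}\<close>
  suffice.\<close>

lemma norm_vector_derivative_diff_le: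
  fixes g :: "real \<Rightarrow> 'a::real_normed_vector"
  assumes lip: "L-lipschitz_on {a..b} (\<lambda>s. g s - s *\<^sub>R v)" and t: "t \<in> {a<..<b}"
    and X: "{a..b} \<subseteq> X" and der: "(g has_vector_derivative w) (at t within X)"
  shows "norm (w - v) \<le> L"
proof (rule field_le_epsilon)
  fix e :: real assume "0 < e"
  then obtain d where d: "0 < d" "\<And>y. y \<in> X \<Longrightarrow> norm (y - t) < d \<Longrightarrow>
      norm (g y - g t - (y - t) *\<^sub>R w) \<le> e * norm (y - t)"
    using der unfolding has_vector_derivative_def has_derivative_within_alt by blast
  define h where "h = min (d / 2) (b - t)"
  have h: "0 < h" "h < d" "t + h \<in> {a..b}" "t \<in> {a..b}"
    using d t by (auto simp: h_def)
  have "norm (g (t + h) - g t - h *\<^sub>R w) \<le> e * h"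
    using d(2)[of "t + h"] h X by (auto simp: subset_iff)
  moreover have "norm (g (t + h) - g t - h *\<^sub>R v) \<le> L * h"
    using lipschitz_on_normD[OF lip h(3,4)] h by (simp add: algebra_simps)
  moreover have "h *\<^sub>R (w - v) = (g (t + h) - g t - h *\<^sub>R v) - (g (t + h) - g t - h *\<^sub>R w)"
    by (simp add: algebra_simps)
  ultimately have "norm (h *\<^sub>R (w - v)) \<le> L * h + e * h"
    by (metis add_mono norm_triangle_ineq4 order_trans)
  then have "h * norm (w - v) \<le> h * (L + e)"
    using h by (simp add: distrib_left mult.commute)
  then show "norm (w - v) \<le> L + e"
    using h by simp
qed

text \<open>This turns quadratic closeness of the limit curve to a finite stage into equality of
  derivatives at \<open>t\<close>.\<close>

lemma has_vector_derivative_zero_quadratic: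
  fixes g :: "real \<Rightarrow> 'a::real_normed_vector"
  assumes "\<And>s. norm (g s) \<le> C * (s - t)\<^sup>2"
  shows "(g has_vector_derivative 0) (at t within X)"
  unfolding has_vector_derivative_def has_derivative_within_alt
proof (intro conjI allI impI)
  fix e :: real assume "0 < e"
  have "g t = 0" using assms[of t] by simp
  have "norm (g y) \<le> e * \<bar>y - t\<bar>" if "\<bar>y - t\<bar> < e / (\<bar>C\<bar> + 1)" for y
  proof -
    have "\<bar>C\<bar> * \<bar>y - t\<bar> \<le> (\<bar>C\<bar> + 1) * \<bar>y - t\<bar>"
      by (simp add: distrib_right)
    also have "\<dots> \<le> e"
      using that by (simp add: pos_less_divide_eq mult.commute)
    finally have "\<bar>C\<bar> * \<bar>y - t\<bar> * \<bar>y - t\<bar> \<le> e * \<bar>y - t\<bar>"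
      by (simp add: mult_right_mono)
    moreover have "C * (y - t)\<^sup>2 \<le> \<bar>C\<bar> * (y - t)\<^sup>2"
      by (simp add: mult_right_mono)
    ultimately show ?thesis
      using assms[of y] by (simp add: power2_eq_square mult.assoc)
  qed
  then show "\<exists>d>0. \<forall>y\<in>X. norm (y - t) < d \<longrightarrow> norm (g y - g t - (y - t) *\<^sub>R 0) \<le> e * norm (y - t)"
    using \<open>0 < e\<close> \<open>g t = 0\<close> by (intro exI[of _ "e / (\<bar>C\<bar> + 1)"]) auto
qed simp

lemma lipschitz_on_pointwise_limit:
  assumes "\<And>n. n \<ge> N \<Longrightarrow> L-lipschitz_on X (g n)" "\<And>x. x \<in> X \<Longrightarrow> (\<lambda>n. g n x) \<longlonglongrightarrow> h x"
  shows "L-lipschitz_on X h"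
proof (rule lipschitz_onI)
  show "0 \<le> L" using assms(1)[of N] lipschitz_on_nonneg by blast
  fix x y assume xy: "x \<in> X" "y \<in> X"
  have "(\<lambda>n. dist (g n x) (g n y)) \<longlonglongrightarrow> dist (h x) (h y)"
    using assms(2) xy by (intro tendsto_intros)
  then show "dist (h x) (h y) \<le> L * dist x y"
    by (rule LIMSEQ_le_const2) (use assms(1) xy in \<open>auto intro: lipschitz_onD\<close>)
qed

text \<open>The $j$-th removed interval has length at most $m / 2^{j+1}$, and index $0$ does not occur, so in
  total at most $m / 2$ is removed.\<close>

lemma emeasure_diff_small_intervals_pos:
  fixes a b :: "nat \<Rightarrow> real"
  assumes C: "compact C" "0 < measure lebesgue C" and I: "0 \<notin> I"
    and ab: "\<And>j. j \<in> I \<Longrightarrow> a j \<le> b j"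
    and small: "\<And>j. j \<in> I \<Longrightarrow> (b j - a j) * 2 ^ Suc j \<le> measure lebesgue C"
  shows "0 < emeasure lebesgue (C - (\<Union>j\<in>I. {a j..b j}))"
proof (rule ccontr)
  let ?m = "measure lebesgue C"
  define A where "A n = (if Suc n \<in> I then {a (Suc n)..b (Suc n)} else {})" for n
  have UA: "(\<Union>j\<in>I. {a j..b j}) = (\<Union>n. A n)"
    using I by (auto simp: A_def split: if_splits) (metis not0_implies_Suc)
  have A_sets: "A n \<in> sets lebesgue" "emeasure lebesgue (A n) < \<infinity>" for n
    by (auto simp: A_def emeasure_lborel_Icc_eq)
  have A_le: "measure lebesgue (A n) \<le> ?m / 4 * (1 / 2) ^ n" for n
  proof (cases "Suc n \<in> I")
    case True
    have "(b (Suc n) - a (Suc n)) * (4 * 2 ^ n) \<le> ?m"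
      using small[OF True] by simp
    then have "b (Suc n) - a (Suc n) \<le> ?m / (4 * 2 ^ n)"
      by (simp add: pos_le_divide_eq)
    then show ?thesis
      using True ab[OF True] by (simp add: A_def power_one_over)
  qed (use C in \<open>auto simp: A_def\<close>)
  have geo: "summable (\<lambda>n. ?m / 4 * (1 / 2) ^ n)"
    by (intro summable_mult summable_geometric) auto
  have sA: "summable (\<lambda>n. measure lebesgue (A n))"
    by (rule summable_comparison_test'[OF geo]) (use A_le in auto)
  have "(\<Sum>n. measure lebesgue (A n)) \<le> (\<Sum>n. ?m / 4 * (1 / 2) ^ n)"
    by (rule suminf_le[OF A_le sA geo])
  also have "\<dots> = ?m / 2"
    by (subst suminf_mult) (auto simp: suminf_geometric)
  finally have le: "(\<Sum>n. measure lebesgue (A n)) \<le> ?m / 2" .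
  have Cs: "C \<in> sets lebesgue"
    using C(1) lmeasurable_compact by blast
  assume "\<not> 0 < emeasure lebesgue (C - (\<Union>j\<in>I. {a j..b j}))"
  then have z: "emeasure lebesgue (C - (\<Union>n. A n)) = 0"
    by (simp add: UA)
  have "ennreal ?m = emeasure lebesgue C"
    using C(1) by (simp add: emeasure_eq_measure2 lmeasurable_compact)
  also have "\<dots> \<le> emeasure lebesgue ((C - (\<Union>n. A n)) \<union> (\<Union>n. A n))"
    using A_sets Cs by (intro emeasure_mono) auto
  also have "\<dots> \<le> emeasure lebesgue (C - (\<Union>n. A n)) + emeasure lebesgue (\<Union>n. A n)"
    using A_sets Cs by (intro emeasure_subadditive) auto
  also have "\<dots> \<le> ennreal (\<Sum>n. measure lebesgue (A n))"
    using emeasure_union_summable[OF A_sets sA] z by simp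
  also have "\<dots> \<le> ennreal (?m / 2)"
    using le by (intro ennreal_leI)
  finally show False
    using C(2) by (simp add: ennreal_le_iff2)
qed

section \<open>Gluing, translating and tilting Lipschitz maps\<close>

lemma lipschitz_on_join:
  fixes g :: "real \<Rightarrow> 'a::metric_space"
  assumes "L-lipschitz_on {a..b} g" "L-lipschitz_on {b..c} g"
  shows "L-lipschitz_on {a..c} g"
  using lipschitz_on_concat[OF assms] by simp

lemma lipschitz_on_scaleR_const:
  fixes w :: "'a::real_normed_vector"
  shows "(norm w)-lipschitz_on X (\<lambda>t. t *\<^sub>R w)"
  by (rule lipschitz_onI) (auto simp: dist_norm mult.commute simp flip: scaleR_diff_left)

lemma lipschitz_on_change_drift:
  fixes g :: "real \<Rightarrow> 'a::real_normed_vector"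
  assumes "L-lipschitz_on X (\<lambda>t. g t - t *\<^sub>R a)"
  shows "(L + norm (a - b))-lipschitz_on X (\<lambda>t. g t - t *\<^sub>R b)"
  by (rule lipschitz_on_transform[OF lipschitz_on_add[OF assms lipschitz_on_scaleR_const[of "a - b"]]])
    (simp add: scaleR_diff_right)

lemma lipschitz_on_translate:
  fixes g :: "real \<Rightarrow> 'a::metric_space"
  assumes "L-lipschitz_on {0..len} g"
  shows "L-lipschitz_on {x..x + len} (\<lambda>t. g (t - x))"
proof (rule lipschitz_onI)
  show "0 \<le> L" using assms by (rule lipschitz_on_nonneg)
  fix s t assume "s \<in> {x..x + len}" "t \<in> {x..x + len}"
  then have "dist (g (s - x)) (g (t - x)) \<le> L * dist (s - x) (t - x)"
    by (intro lipschitz_onD[OF assms]) auto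
  then show "dist (g (s - x)) (g (t - x)) \<le> L * dist s t"
    by (simp add: dist_real_def)
qed

lemma lipschitz_on_translate_drift:
  fixes g :: "real \<Rightarrow> 'a::real_normed_vector"
  assumes "L-lipschitz_on {0..len} (\<lambda>t. g t - t *\<^sub>R v)"
  shows "L-lipschitz_on {x..x + len} (\<lambda>t. g (t - x) - t *\<^sub>R v)"
proof -
  have "(L + 0)-lipschitz_on {x..x + len} (\<lambda>t. (g (t - x) - (t - x) *\<^sub>R v) - x *\<^sub>R v)"
    by (rule lipschitz_on_diff[OF lipschitz_on_translate[OF assms] lipschitz_on_constant])
  then show ?thesis
    by (simp add: scaleR_diff_left)
qed

lemma differentiable_translate:
  fixes g :: "real \<Rightarrow> 'a::real_normed_vector"
  assumes "\<forall>t\<in>{0..len}. g differentiable (at t within {0..len})" and t: "t \<in> {x<..<x + len}"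
  shows "(\<lambda>t. g (t - x)) differentiable (at t)"
proof -
  have "g differentiable (at (t - x) within {0..len})"
    using assms by auto
  moreover have "at (t - x) within {0..len} = at (t - x)"
    using t by (intro at_within_Icc_at) auto
  ultimately have "g differentiable (at (t - x))" by simp
  then have "(g \<circ> (\<lambda>t. t - x)) differentiable (at t)"
    by (intro differentiable_chain_at) (auto intro!: derivative_intros)
  then show ?thesis
    by (simp add: o_def)
qed

lemma lipschitz_on_affine_path:
  fixes d :: "'a::real_normed_vector"
  assumes "norm d \<le> \<kappa> * \<bar>c\<bar>" "c \<noteq> 0"
  shows "\<kappa>-lipschitz_on X (\<lambda>t. ((t - b) / c) *\<^sub>R d)"
proof (rule lipschitz_onI)
  have "norm d / \<bar>c\<bar> \<le> \<kappa>"
    using assms by (simp add: pos_divide_le_eq)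
  then show "0 \<le> \<kappa>"
    by (meson abs_ge_zero divide_nonneg_nonneg norm_ge_zero order_trans)
  fix s t :: real
  have "dist (((s - b) / c) *\<^sub>R d) (((t - b) / c) *\<^sub>R d) = norm d / \<bar>c\<bar> * \<bar>s - t\<bar>"
    unfolding dist_norm scaleR_diff_left[symmetric] by (simp flip: diff_divide_distrib)
  also have "\<dots> \<le> \<kappa> * \<bar>s - t\<bar>"
    using \<open>norm d / \<bar>c\<bar> \<le> \<kappa>\<close> by (intro mult_right_mono) auto
  finally show "dist (((s - b) / c) *\<^sub>R d) (((t - b) / c) *\<^sub>R d) \<le> \<kappa> * dist s t"
    by (simp add: dist_real_def)
qed

lemma differentiable_transform_open:
  assumes "f differentiable (at t within X)" "open V" "t \<in> V" "t \<in> X" "\<And>s. s \<in> V \<Longrightarrow> f s = g s"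
  shows "g differentiable (at t within X)"
proof -
  obtain e where "0 < e" "ball t e \<subseteq> V"
    using assms(2,3) openE by blast
  then show ?thesis
    using assms by (intro differentiable_transform_within[OF assms(1)]) (auto simp: dist_commute subset_iff)
qed

section \<open>Splicing an arc into a curve\<close>

definition graft :: "(real \<Rightarrow> 'a::real_vector) \<Rightarrow> (real \<Rightarrow> 'a) \<Rightarrow> real \<Rightarrow> real \<Rightarrow> real \<Rightarrow> real \<Rightarrow> real \<Rightarrow> 'a" where
  "graft \<beta> \<alpha> m l r n t =
     (if t \<in> {l..r} then \<alpha> t
      else if t \<in> {m..l} then \<beta> t + ((t - m) / (l - m)) *\<^sub>R (\<alpha> l - \<beta> l)
      else if t \<in> {r..n} then \<beta> t + ((t - n) / (r - n)) *\<^sub>R (\<alpha> r - \<beta> r)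
      else \<beta> t)"

text \<open>Neighbouring branches agree at the common endpoints, so each formula holds on a closed
  interval, as needed for gluing Lipschitz bounds.\<close>

lemma graft_simps:
  assumes "m < l" "l < r" "r < n"
  shows "t \<in> {l..r} \<Longrightarrow> graft \<beta> \<alpha> m l r n t = \<alpha> t"
    and "t \<in> {m..l} \<Longrightarrow> graft \<beta> \<alpha> m l r n t = \<beta> t + ((t - m) / (l - m)) *\<^sub>R (\<alpha> l - \<beta> l)"
    and "t \<in> {r..n} \<Longrightarrow> graft \<beta> \<alpha> m l r n t = \<beta> t + ((t - n) / (r - n)) *\<^sub>R (\<alpha> r - \<beta> r)"
    and "t \<notin> {m<..<n} \<Longrightarrow> graft \<beta> \<alpha> m l r n t = \<beta> t"
proof -
  show "t \<in> {m..l} \<Longrightarrow> graft \<beta> \<alpha> m l r n t = \<beta> t + ((t - m) / (l - m)) *\<^sub>R (\<alpha> l - \<beta> l)"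
    using assms by (cases "t = l") (auto simp: graft_def)
  show "t \<in> {r..n} \<Longrightarrow> graft \<beta> \<alpha> m l r n t = \<beta> t + ((t - n) / (r - n)) *\<^sub>R (\<alpha> r - \<beta> r)"
    using assms by (cases "t = r") (auto simp: graft_def)
  show "t \<notin> {m<..<n} \<Longrightarrow> graft \<beta> \<alpha> m l r n t = \<beta> t"
    using assms by (cases "t = m"; cases "t = n") (auto simp: graft_def)
qed (simp add: graft_def)

text \<open>The ramps have slope at most \<open>\<kappa>\<close>, paid for by the gap between the
  local constant \<open>L0\<close> and \<open>L\<close>. The free drift \<open>u\<close> lets one
  lemma serve both the speed bound (\<open>u = 0\<close>) and the closeness to the velocity of an
  earlier arc.\<close>

lemma lipschitz_on_graft:
  fixes \<alpha> \<beta> :: "real \<Rightarrow> 'a::real_normed_vector"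
  assumes ord: "a \<le> m" "m < l" "l < r" "r < n" "n \<le> b"
    and L: "L-lipschitz_on {a..b} (\<lambda>t. \<beta> t - t *\<^sub>R u)"
    and L0: "L0-lipschitz_on {m..n} (\<lambda>t. \<beta> t - t *\<^sub>R u)" "L0 + \<kappa> \<le> L"
    and \<alpha>: "L-lipschitz_on {l..r} (\<lambda>t. \<alpha> t - t *\<^sub>R u)"
    and l: "norm (\<alpha> l - \<beta> l) \<le> \<kappa> * (l - m)" and r: "norm (\<alpha> r - \<beta> r) \<le> \<kappa> * (n - r)"
  shows "L-lipschitz_on {a..b} (\<lambda>t. graft \<beta> \<alpha> m l r n t - t *\<^sub>R u)"
proof -
  note sp = graft_simps[OF ord(2,3,4)]
  let ?g = "\<lambda>t. graft \<beta> \<alpha> m l r n t - t *\<^sub>R u"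
  have 1: "L-lipschitz_on {a..m} ?g"
    using ord by (intro lipschitz_on_transform[OF lipschitz_on_subset[OF L]]) (auto simp: sp(4))
  have 5: "L-lipschitz_on {n..b} ?g"
    using ord by (intro lipschitz_on_transform[OF lipschitz_on_subset[OF L]]) (auto simp: sp(4))
  have 3: "L-lipschitz_on {l..r} ?g"
    by (rule lipschitz_on_transform[OF \<alpha>]) (simp add: sp(1))
  have "(L0 + \<kappa>)-lipschitz_on {m..l} (\<lambda>t. (\<beta> t - t *\<^sub>R u) + ((t - m) / (l - m)) *\<^sub>R (\<alpha> l - \<beta> l))"
    using ord l by (intro lipschitz_on_add lipschitz_on_affine_path lipschitz_on_subset[OF L0(1)]) auto
  then have 2: "L-lipschitz_on {m..l} ?g"
    using L0(2) by (rule lipschitz_on_transform[OF lipschitz_on_le]) (simp add: sp(2))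
  have "(L0 + \<kappa>)-lipschitz_on {r..n} (\<lambda>t. (\<beta> t - t *\<^sub>R u) + ((t - n) / (r - n)) *\<^sub>R (\<alpha> r - \<beta> r))"
    using ord r by (intro lipschitz_on_add lipschitz_on_affine_path lipschitz_on_subset[OF L0(1)]) auto
  then have 4: "L-lipschitz_on {r..n} ?g"
    using L0(2) by (rule lipschitz_on_transform[OF lipschitz_on_le]) (simp add: sp(3))
  show ?thesis
    by (rule lipschitz_on_join[OF 1 lipschitz_on_join[OF 2 lipschitz_on_join[OF 3 lipschitz_on_join[OF 4 5]]]])
qed

lemma finite_not_differentiable_graft:
  fixes \<alpha> \<beta> :: "real \<Rightarrow> 'a::real_normed_vector"
  assumes ord: "m < l" "l < r" "r < n"
    and \<beta>: "finite {t\<in>X. \<not> \<beta> differentiable (at t within X)}"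
    and \<alpha>: "\<And>t. t \<in> {l<..<r} \<Longrightarrow> \<alpha> differentiable (at t)"
  shows "finite {t\<in>X. \<not> graft \<beta> \<alpha> m l r n differentiable (at t within X)}"
proof (rule finite_subset)
  note sp = graft_simps[OF ord]
  let ?g = "graft \<beta> \<alpha> m l r n"
  show "finite ({t\<in>X. \<not> \<beta> differentiable (at t within X)} \<union> {m, l, r, n})"
    using \<beta> by simp
  show "{t\<in>X. \<not> ?g differentiable (at t within X)} \<subseteq> {t\<in>X. \<not> \<beta> differentiable (at t within X)} \<union> {m, l, r, n}"
  proof safe
    fix t assume t: "t \<in> X" "t \<noteq> m" "t \<noteq> l" "t \<noteq> r" "t \<noteq> n"
      and not: "\<not> ?g differentiable (at t within X)" and d: "\<beta> differentiable (at t within X)"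
    consider "t \<in> - {m..n}" | "t \<in> {m<..<l}" | "t \<in> {l<..<r}" | "t \<in> {r<..<n}"
      using t by fastforce
    then have "?g differentiable (at t within X)"
    proof cases
      case 1
      then show ?thesis
        by (intro differentiable_transform_open[OF d _ 1 t(1)]) (auto simp: sp(4))
    next
      case 2
      have "(\<lambda>t. \<beta> t + ((t - m) / (l - m)) *\<^sub>R (\<alpha> l - \<beta> l)) differentiable (at t within X)"
        using ord by (intro differentiable_add d differentiable_scaleR derivative_intros) auto
      then show ?thesis
        by (rule differentiable_transform_open[OF _ _ 2 t(1)]) (auto simp: sp(2))
    next
      case 3
      show ?thesis
        by (rule differentiable_transform_open[OF differentiable_at_withinI[OF \<alpha>[OF 3]] _ 3 t(1)]) (auto simp: sp(1))
    next
      case 4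
      have "(\<lambda>t. \<beta> t + ((t - n) / (r - n)) *\<^sub>R (\<alpha> r - \<beta> r)) differentiable (at t within X)"
        using ord by (intro differentiable_add d differentiable_scaleR derivative_intros) auto
      then show ?thesis
        by (rule differentiable_transform_open[OF _ _ 4 t(1)]) (auto simp: sp(3))
    qed
    with not show False ..
  qed
qed

text \<open>Density of \<open>H\<close> supplies a point \<open>z\<close> of \<open>S\<close> in
  \<open>H\<close> near \<open>y\<close>; stabilising the direction in a small ball about
  \<open>z\<close>, with directions confined to \<open>cball v \<kappa>\<close>, gives the new
  region, and a short enough arc stays in \<open>H\<close>.\<close>

lemma exists_arc_nearby:
  fixes S :: "'a::euclidean_space set"
  assumes st: "stable_direction S V v \<kappa>" and y: "y \<in> V" "y \<in> S"
    and pos: "0 < \<rho>" "0 < \<epsilon>" "\<epsilon> \<le> 1 / 32" "0 < \<delta>"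
    and H: "open H" "\<And>U. open U \<Longrightarrow> U \<inter> S \<noteq> {} \<Longrightarrow> U \<inter> S \<inter> H \<noteq> {}"
  obtains V' v' \<alpha> len P where
    "V' \<subseteq> ball y \<rho>" "stable_direction S V' v' \<epsilon>" "norm (v' - v) \<le> \<kappa> + \<epsilon>" "0 < len" "len \<le> \<delta>"
    "\<forall>t\<in>{0..len}. \<alpha> differentiable (at t within {0..len})"
    "(1 - \<epsilon>)-lipschitz_on {0..len} \<alpha>" "(4 * \<epsilon>)-lipschitz_on {0..len} (\<lambda>t. \<alpha> t - t *\<^sub>R v')"
    "compact P" "P \<subseteq> {0<..<len}" "0 < measure lebesgue P" "\<alpha> ` P \<subseteq> V' \<inter> S"
    "cball (\<alpha> 0) len \<subseteq> H"
proof -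
  have V: "open V" and dir: "\<And>W. open W \<Longrightarrow> W \<subseteq> V \<Longrightarrow> W \<inter> S \<noteq> {} \<Longrightarrow> \<exists>u. admits_direction S W u \<and> norm (u - v) \<le> \<kappa>"
    using st by (auto simp: stable_direction_def)
  obtain z where z: "z \<in> V \<inter> ball y \<rho>" "z \<in> S" "z \<in> H"
    using H(2)[of "V \<inter> ball y \<rho>"] V y pos(1) by fastforce
  have "open (V \<inter> ball y \<rho> \<inter> H)"
    using V H(1) by auto
  then obtain \<sigma> where \<sigma>: "0 < \<sigma>" "ball z \<sigma> \<subseteq> V \<inter> ball y \<rho> \<inter> H"
    using z openE[of "V \<inter> ball y \<rho> \<inter> H" z] by blast
  have "ball z (\<sigma> / 2) \<subseteq> ball z \<sigma>"
    using \<sigma>(1) by (intro subset_ball) auto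
  then have sub: "ball z (\<sigma> / 2) \<subseteq> V" "ball z (\<sigma> / 2) \<subseteq> ball y \<rho>"
    using \<sigma>(2) by blast+
  have meets: "ball z (\<sigma> / 2) \<inter> S \<noteq> {}"
    using z(2) \<sigma>(1) by force
  have ex: "\<forall>W. open W \<and> W \<subseteq> ball z (\<sigma> / 2) \<and> W \<inter> S \<noteq> {} \<longrightarrow> (\<exists>u\<in>cball v \<kappa>. admits_direction S W u)"
  proof (intro allI impI, elim conjE)
    fix W assume "open W" "W \<subseteq> ball z (\<sigma> / 2)" "W \<inter> S \<noteq> {}"
    then obtain u where "admits_direction S W u" "norm (u - v) \<le> \<kappa>"
      using dir[of W] sub(1) by blast
    then show "\<exists>u\<in>cball v \<kappa>. admits_direction S W u"
      by (intro bexI[of _ u]) (auto simp: dist_norm norm_minus_commute)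
  qed
  obtain v' V' u0 where v': "V' \<subseteq> ball z (\<sigma> / 2)" "stable_direction S V' v' \<epsilon>" "u0 \<in> cball v \<kappa>" "norm (u0 - v') \<le> \<epsilon>"
    by (rule exists_stable_direction[OF pos(2) open_ball meets ex])
  have "norm (v' - v) \<le> \<kappa> + \<epsilon>"
    using v'(3,4) norm_triangle_ineq[of "v' - u0" "u0 - v"] by (simp add: dist_norm norm_minus_commute)
  obtain u where u: "admits_direction S V' u" "norm (u - v') \<le> \<epsilon>"
    using v'(2) unfolding stable_direction_def by blast
  \<comment> \<open>Speed \<open>1 - 2 * \<epsilon>\<close> with error \<open>\<epsilon>\<close>
    leaves slack \<open>\<epsilon>\<close> below 1. The distance to \<open>v'\<close> is at most
    \<open>\<epsilon>\<close> from the direction plus \<open>2 * \<epsilon>\<close> from the speed;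
    with the arc error this makes \<open>4 * \<epsilon>\<close>.\<close>
  let ?w = "(1 - 2 * \<epsilon>) *\<^sub>R u"
  have "norm u = 1" using u(1) by (simp add: admits_direction_def)
  have arc0: "short_arc S V' ?w"
    using u(1) pos(3) by (simp add: admits_direction_def)
  \<comment> \<open>The arc hits \<open>ball z (\<sigma> / 2)\<close>, so with length at most
    \<open>\<sigma> / 4\<close> its start is within three quarters of \<open>\<sigma>\<close> of
    \<open>z\<close>, and the ball of radius \<open>len\<close> about the start still fits in
    \<open>ball z \<sigma>\<close>.\<close>
  have min0: "0 < min \<delta> (\<sigma> / 4)"
    using pos(4) \<sigma>(1) by simp
  obtain len \<alpha> P where arc: "0 < len" "len \<le> min \<delta> (\<sigma> / 4)"
    "\<forall>t\<in>{0..len}. \<alpha> differentiable (at t within {0..len})"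
    "\<epsilon>-lipschitz_on {0..len} (\<lambda>t. \<alpha> t - t *\<^sub>R ?w)"
    "compact P" "P \<subseteq> {0<..<len}" "0 < measure lebesgue P" "\<alpha> ` P \<subseteq> V' \<inter> S"
    using arc0[unfolded short_arc_def, rule_format, OF pos(2) min0] by blast
  have "(\<epsilon> + norm ?w)-lipschitz_on {0..len} (\<lambda>t. (\<alpha> t - t *\<^sub>R ?w) + t *\<^sub>R ?w)"
    by (rule lipschitz_on_add[OF arc(4) lipschitz_on_scaleR_const])
  moreover have "norm ?w = 1 - 2 * \<epsilon>"
    using \<open>norm u = 1\<close> pos(3) by simp
  ultimately have lip: "(1 - \<epsilon>)-lipschitz_on {0..len} \<alpha>"
    by simp
  have "norm (?w - v') \<le> 3 * \<epsilon>"
  proof -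
    have "?w - v' = (u - v') - (2 * \<epsilon>) *\<^sub>R u"
      by (simp add: algebra_simps)
    then have "norm (?w - v') \<le> norm (u - v') + norm ((2 * \<epsilon>) *\<^sub>R u)"
      by (metis norm_triangle_ineq4)
    then show ?thesis
      using u(2) \<open>norm u = 1\<close> pos(2) by simp
  qed
  then have le: "\<epsilon> + norm (?w - v') \<le> 4 * \<epsilon>" by simp
  have drift: "(4 * \<epsilon>)-lipschitz_on {0..len} (\<lambda>t. \<alpha> t - t *\<^sub>R v')"
    by (rule lipschitz_on_transform[OF lipschitz_on_le[OF lipschitz_on_add[OF arc(4) lipschitz_on_scaleR_const] le]])
      (simp add: scaleR_diff_right)
  obtain c where c: "c \<in> P"
    using arc(7) by (metis all_not_in_conv less_irrefl measure_empty)
  have c': "c \<in> {0..len}"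
    using c arc(6) by auto
  have ac: "\<alpha> c \<in> ball z (\<sigma> / 2)"
    using c arc(8) v'(1) by blast
  have "dist (\<alpha> 0) (\<alpha> c) \<le> (1 - \<epsilon>) * dist 0 c"
    using c' arc(1) by (intro lipschitz_onD[OF lip]) auto
  also have "\<dots> \<le> 1 * len"
    using c' pos by (intro mult_mono) (auto simp: dist_real_def)
  finally have "dist z (\<alpha> 0) < \<sigma> / 2 + len"
    using ac dist_triangle[of z "\<alpha> 0" "\<alpha> c"] by (simp add: dist_commute)
  then have "dist z t < \<sigma>" if "dist (\<alpha> 0) t \<le> len" for t
    using that arc(2) dist_triangle[of z t "\<alpha> 0"] by auto
  then have "cball (\<alpha> 0) len \<subseteq> ball z \<sigma>"
    by auto
  then have "cball (\<alpha> 0) len \<subseteq> H"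
    using \<sigma>(2) by blast
  then show thesis
    using that[of V' v' len \<alpha> P] v'(1,2) sub(2) \<open>norm (v' - v) \<le> \<kappa> + \<epsilon>\<close> arc lip drift by auto
qed

subsection \<open>Grafting one more arc\<close>

text \<open>Velocities in arc \<open>k\<close> may forever vary by \<open>8 * tol k\<close> about
  \<open>vel\<close>. At the root this is 1/4, so the speed stays at least 3/4. Halving makes room
  for nesting: with host tolerance \<open>\<kappa>\<close> and
  \<open>2 * \<epsilon> \<le> \<kappa>\<close>, a direction change
  \<open>\<kappa> + \<epsilon>\<close> plus \<open>8 * \<epsilon>\<close> stays below
  \<open>8 * \<kappa>\<close>.\<close>

definition tol :: "nat \<Rightarrow> real" where "tol k = (1 / 2) ^ k / 32"

lemma tol_pos: "0 < tol k" and tol_le: "tol k \<le> 1 / 32"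
  by (auto simp: tol_def power_le_one)

lemma tol_mono: "j \<le> k \<Longrightarrow> tol k \<le> tol j"
  by (simp add: tol_def power_decreasing)

lemma tol_less_half: "j < k \<Longrightarrow> 2 * tol k \<le> tol j"
  using power_decreasing[of "Suc j" k "1 / 2 :: real"] by (simp add: tol_def)

lemma tol_tendsto_0: "tol \<longlonglongrightarrow> 0"
proof -
  have "(\<lambda>k. (1 / 2) ^ k / 32) \<longlonglongrightarrow> 0 / (32 :: real)"
    by (intro tendsto_divide LIMSEQ_power_zero tendsto_const) auto
  then show ?thesis by (simp add: tol_def[abs_def])
qed

text \<open>
  Step \<open>k\<close> of the construction produces the curve \<open>crv\<close>, which differs from the previous one only between \<open>mlo\<close>
  and \<open>mhi\<close> and is the new arc, with velocity close to \<open>vel\<close>, between \<open>lo\<close> and \<open>hi\<close>. The compact set \<open>core\<close> of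
  times has positive measure and is mapped into \<open>reg \<inter> \<F>\<close>, where the region \<open>reg\<close> has stable direction \<open>vel\<close>.
\<close>

record 'a node =
  crv :: "real \<Rightarrow> 'a"
  lo :: real
  hi :: real
  mlo :: real
  mhi :: real
  vel :: 'a
  reg :: "'a set"
  core :: "real set"

abbreviation zone :: "'a node \<Rightarrow> real set" where "zone r \<equiv> {mlo r..mhi r}"

text \<open>The ball about the starting point contains the image of \<open>{lo r..hi r}\<close>
  under every 1-Lipschitz map that agrees with \<open>crv r\<close> at \<open>lo r\<close>.
  Membership in the open set \<open>G k\<close> thus passes to the limit curve. The bound
  \<open>1 - tol k\<close> is the slack that pays for the ramps of later grafts.\<close>

definition node_ok :: "'a::euclidean_space set \<Rightarrow> (nat \<Rightarrow> 'a set) \<Rightarrow> nat \<Rightarrow> 'a node \<Rightarrow> bool" where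
  "node_ok S G k r \<longleftrightarrow>
     0 < mlo r \<and> mlo r \<le> lo r \<and> lo r < hi r \<and> hi r \<le> mhi r \<and> mhi r < 1 \<and> hi r - lo r \<le> (1 / 2) ^ k \<and>
     compact (core r) \<and> core r \<subseteq> {lo r<..<hi r} \<and> 0 < measure lebesgue (core r) \<and>
     crv r ` core r \<subseteq> reg r \<inter> S \<and> stable_direction S (reg r) (vel r) (tol k) \<and>
     cball (crv r (lo r)) (hi r - lo r) \<subseteq> G k \<and>
     1-lipschitz_on {0..1} (crv r) \<and> (1 - tol k)-lipschitz_on {lo r..hi r} (crv r) \<and>
     (4 * tol k)-lipschitz_on {lo r..hi r} (\<lambda>t. crv r t - t *\<^sub>R vel r) \<and>
     finite {t\<in>{0..1}. \<not> crv r differentiable (at t within {0..1})}"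

text \<open>The velocity inequality says that the ball of radius \<open>8 * tol k\<close> about
  \<open>vel r\<close> lies in that of radius \<open>8 * tol j\<close> about
  \<open>vel (f j)\<close>. The last clause makes all zones after \<open>j\<close> too short to
  exhaust \<open>core (f j)\<close>.\<close>

definition linked :: "(nat \<Rightarrow> 'a::euclidean_space node) \<Rightarrow> nat \<Rightarrow> 'a node \<Rightarrow> bool" where
  "linked f k r \<longleftrightarrow> (\<forall>j<k.
     (zone r \<inter> zone (f j) = {} \<or>
      zone r \<subseteq> {lo (f j)<..<hi (f j)} \<and> norm (vel r - vel (f j)) + 8 * tol k \<le> 8 * tol j) \<and>
     (8 * tol j)-lipschitz_on {lo (f j)..hi (f j)} (\<lambda>t. crv r t - t *\<^sub>R vel (f j)) \<and>
     (mhi r - mlo r) * 2 ^ Suc k \<le> measure lebesgue (core (f j)))"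

text \<open>Here \<open>r\<close> is the node of index \<open>Suc n\<close>, and
  \<open>p \<le> n\<close>. If \<open>B i\<close> misses what is left of the core of
  \<open>p\<close>, the graft may go elsewhere in the zone of \<open>p\<close>, so every
  \<open>n\<close> yields a node. The power of 1/8 is the cube of that of 1/2, which gives the
  quadratic estimate for the limit curve.\<close>

definition refines :: "(nat \<Rightarrow> real set) \<Rightarrow> (nat \<Rightarrow> 'a::euclidean_space node) \<Rightarrow> nat \<Rightarrow> 'a node \<Rightarrow> bool" where
  "refines B f n r \<longleftrightarrow>
     (\<forall>t. t \<notin> {mlo r<..<mhi r} \<longrightarrow> crv r t = crv (f n) t) \<and> mhi r - mlo r \<le> (1 / 8) ^ n \<and>
     (case prod_decode n of (p, i) \<Rightarrow> zone r \<subseteq> zone (f p) \<and>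
       (core (f p) \<inter> B i - (\<Union>j\<in>{p<..n}. zone (f j)) \<noteq> {} \<longrightarrow> zone r \<subseteq> B i))"

lemma refinesD: "refines B f n r \<Longrightarrow> t \<notin> zone r \<Longrightarrow> crv r t = crv (f n) t"
  by (auto simp: refines_def)

lemma exists_next_node:
  fixes S :: "'a::euclidean_space set"
  assumes G: "\<And>n. open (G n)" "\<And>n U. open U \<Longrightarrow> U \<inter> S \<noteq> {} \<Longrightarrow> U \<inter> S \<inter> G n \<noteq> {}"
    and B: "\<And>i. open (B i)"
    and node: "\<And>j. j \<le> n \<Longrightarrow> node_ok S G j (f j)"
    and link: "\<And>j. j \<le> n \<Longrightarrow> linked f j (f j)"
    and refine: "\<And>j. j < n \<Longrightarrow> refines B f j (f (Suc j))"
  shows "\<exists>r. node_ok S G (Suc n) r \<and> linked f (Suc n) r \<and> refines B f n r"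
proof -
  obtain p i where pi: "prod_decode n = (p, i)" by force
  then have pn: "p \<le> n"
    by (metis le_prod_encode_1 prod_decode_inverse)
  define Z where "Z = (\<Union>j\<in>{p<..n}. zone (f j))"
  define \<beta> where "\<beta> = crv (f n)"
  define \<kappa> where "\<kappa> = tol p"
  define \<epsilon> where "\<epsilon> = tol (Suc n)"
  define v where "v = vel (f p)"
  have eps: "0 < \<epsilon>" "\<epsilon> \<le> 1 / 32" "2 * \<epsilon> \<le> \<kappa>" "0 < \<kappa>" "\<kappa> \<le> 1 / 32"
    using tol_less_half[of p "Suc n"] pn tol_le[of p] tol_le[of "Suc n"]
    by (simp_all add: \<epsilon>_def \<kappa>_def tol_pos)
  note np = node[OF pn, unfolded node_ok_def, folded \<kappa>_def v_def]
  have bounds_p: "0 < lo (f p)" "hi (f p) < 1" "{lo (f p)<..<hi (f p)} \<subseteq> zone (f p)"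
    using np by auto
  have bounds: "mlo (f j) \<le> lo (f j)" "lo (f j) < hi (f j)" "hi (f j) \<le> mhi (f j)"
    "0 < measure lebesgue (core (f j))" if "j \<le> n" for j
    using node[OF that] by (auto simp: node_ok_def)
  have "0 < emeasure lebesgue (core (f p) - Z)"
    unfolding Z_def
  proof (rule emeasure_diff_small_intervals_pos)
    show "compact (core (f p))" "0 < measure lebesgue (core (f p))"
      using np by auto
    fix j assume j: "j \<in> {p<..n}"
    then show "(mhi (f j) - mlo (f j)) * 2 ^ Suc j \<le> measure lebesgue (core (f p))"
      using link[of j] by (simp add: linked_def)
    show "mlo (f j) \<le> mhi (f j)" using bounds[of j] j by auto
  qed simp
  then have "core (f p) - Z \<noteq> {}"
    by (metis emeasure_empty less_irrefl)
  \<comment> \<open>The point lies in \<open>B i\<close> whenever the pair \<open>(p, i)\<close> can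
    be served; otherwise any surviving core time will do.\<close>
  then obtain x where x: "x \<in> core (f p) - Z" and xB: "core (f p) \<inter> B i - Z \<noteq> {} \<Longrightarrow> x \<in> B i"
    by blast
  define W where "W = {lo (f p)<..<hi (f p)} \<inter> - Z \<inter> (if core (f p) \<inter> B i - Z \<noteq> {} then B i else UNIV)"
  have "closed Z"
    unfolding Z_def by (intro closed_UN) auto
  then have "open W"
    unfolding W_def using B by (intro open_Int) auto
  moreover have "x \<in> W"
    using x xB np by (auto simp: W_def)
  ultimately obtain h0 where h0: "0 < h0" "cball x h0 \<subseteq> W"
    using open_contains_cball by blast
  define \<mu> where "\<mu> = Min ((\<lambda>j. measure lebesgue (core (f j))) ` {..n})"
  have "0 < \<mu>"
    unfolding \<mu>_def using bounds(4) by (subst Min_gr_iff) auto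
  have \<mu>: "\<mu> \<le> measure lebesgue (core (f j))" if "j \<le> n" for j
    unfolding \<mu>_def using that by (intro Min_le) auto
  \<comment> \<open>The zone will have width \<open>2 * h\<close>. The three entries keep it in
    \<open>W\<close>, give the length demanded by \<open>refines\<close>, and give the measure
    clause of \<open>linked\<close> at index \<open>Suc n\<close>.\<close>
  define h where "h = Min {h0, (1 / 8) ^ n / 2, \<mu> / (2 * 2 ^ Suc (Suc n))}"
  have "0 < h" "h \<le> h0" "h \<le> (1 / 8) ^ n / 2" "h \<le> \<mu> / (2 * 2 ^ Suc (Suc n))"
    using h0(1) \<open>0 < \<mu>\<close> by (auto simp: h_def)
  then have h: "0 < h" "h \<le> h0" "2 * h \<le> (1 / 8) ^ n" "2 * h * 2 ^ Suc (Suc n) \<le> \<mu>"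
    by (auto simp: field_simps)
  let ?M = "{x - h..x + h}"
  have M: "?M \<subseteq> W"
    using h0(2) h(2) by (auto simp: cball_eq_atLeastAtMost)
  then have Mp: "?M \<subseteq> {lo (f p)<..<hi (f p)}" and MZ: "?M \<inter> Z = {}"
    by (auto simp: W_def)
  \<comment> \<open>The graft changes the latest curve, whereas the good estimates concern the curve
    of \<open>p\<close>. Both agree on \<open>?M\<close>, since it avoids all zones made in
    between.\<close>
  have \<beta>_eq: "\<beta> t = crv (f p) t" if "t \<in> ?M" for t
  proof -
    have "crv (f j) t = crv (f p) t" if "p \<le> j" "j \<le> n" for j
      using that
    proof (induction j rule: dec_induct)
      case (step j)
      then have "Suc j \<in> {p<..n}" "j < n" by auto
      then have "t \<notin> zone (f (Suc j))"
        using MZ \<open>t \<in> ?M\<close> unfolding Z_def by blast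
      then show ?case
        using step refinesD[OF refine[OF \<open>j < n\<close>]] by simp
    qed simp
    from this[OF pn order_refl] show ?thesis
      by (simp only: \<beta>_def)
  qed
  have \<beta>_lip1: "1-lipschitz_on {0..1} \<beta>"
    using node[of n] by (auto simp: node_ok_def \<beta>_def)
  have Mp': "?M \<subseteq> {lo (f p)..hi (f p)}"
    using Mp by (meson greaterThanLessThan_subseteq_atLeastAtMost_iff order_refl subset_trans)
  have \<beta>_lip: "(1 - \<kappa>)-lipschitz_on ?M \<beta>"
    using np by (intro lipschitz_on_transform[OF lipschitz_on_subset[OF _ Mp'] \<beta>_eq]) auto
  have \<beta>_drift: "(4 * \<kappa>)-lipschitz_on ?M (\<lambda>t. \<beta> t - t *\<^sub>R v)"
    using np by (intro lipschitz_on_transform[OF lipschitz_on_subset[OF _ Mp']]) (auto simp: \<beta>_eq)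
  have xM: "x \<in> ?M" using h by simp
  have y: "\<beta> x \<in> reg (f p)" "\<beta> x \<in> S"
    using np x \<beta>_eq[OF xM] by auto
  \<comment> \<open>The arc starts at time \<open>x\<close>, has a point within
    \<open>\<kappa> * h / 8\<close> of \<open>\<beta> x\<close> and is at most that long. So the
    mismatch is at most 2/8 of \<open>\<kappa> * h\<close> on the left and 3/8 on the right, within
    \<open>\<kappa>\<close> times the ramp lengths \<open>h\<close> and
    \<open>h - len\<close>.\<close>
  define \<delta> where "\<delta> = min (\<kappa> * h / 8) ((1 / 2) ^ Suc n)"
  have \<delta>: "0 < \<delta>" "\<delta> \<le> \<kappa> * h / 8" "\<delta> \<le> (1 / 2) ^ Suc n"
    using eps h by (auto simp: \<delta>_def)
  have \<kappa>h: "0 < \<kappa> * h" "\<kappa> * h \<le> h / 32"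
    using eps h mult_right_mono[OF eps(5), of h] by auto
  have st: "stable_direction S (reg (f p)) v \<kappa>"
    using np by simp
  have \<rho>: "0 < \<kappa> * h / 8" using \<kappa>h by simp
  obtain V' v' \<alpha>0 len P0 where arc: "V' \<subseteq> ball (\<beta> x) (\<kappa> * h / 8)" "stable_direction S V' v' \<epsilon>"
    "norm (v' - v) \<le> \<kappa> + \<epsilon>" "0 < len" "len \<le> \<delta>"
    "\<forall>t\<in>{0..len}. \<alpha>0 differentiable (at t within {0..len})"
    "(1 - \<epsilon>)-lipschitz_on {0..len} \<alpha>0" "(4 * \<epsilon>)-lipschitz_on {0..len} (\<lambda>t. \<alpha>0 t - t *\<^sub>R v')"
    "compact P0" "P0 \<subseteq> {0<..<len}" "0 < measure lebesgue P0" "\<alpha>0 ` P0 \<subseteq> V' \<inter> S"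
    "cball (\<alpha>0 0) len \<subseteq> G (Suc n)"
    by (rule exists_arc_nearby[OF st y \<rho> eps(1,2) \<delta>(1) G(1) G(2)])
  define \<alpha> where "\<alpha> t = \<alpha>0 (t - x)" for t
  define P where "P = (+) x ` P0"
  let ?l = x and ?r = "x + len" and ?m = "x - h" and ?n = "x + h"
  have ord: "?m < ?l" "?l < ?r" "?r < ?n"
    using h arc(4,5) \<delta>(2) \<kappa>h by auto
  have \<alpha>_lip: "(1 - \<epsilon>)-lipschitz_on {?l..?r} \<alpha>"
    unfolding \<alpha>_def by (rule lipschitz_on_translate[OF arc(7)])
  have \<alpha>_drift: "(4 * \<epsilon>)-lipschitz_on {?l..?r} (\<lambda>t. \<alpha> t - t *\<^sub>R v')"
    unfolding \<alpha>_def by (rule lipschitz_on_translate_drift[OF arc(8)])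
  have P: "compact P" "P \<subseteq> {?l<..<?r}" "0 < measure lebesgue P" "\<alpha> ` P \<subseteq> V' \<inter> S"
    using arc(9-12) by (auto simp: P_def \<alpha>_def compact_translation measure_translation)
  obtain c where c: "c \<in> P"
    using P(3) by (metis all_not_in_conv less_irrefl measure_empty)
  have "c \<in> {?l<..<?r}" "\<alpha> c \<in> ball (\<beta> x) (\<kappa> * h / 8)"
    using c P(2,4) arc(1) by blast+
  then have c': "c \<in> {?l..?r}" "dist (\<alpha> c) (\<beta> x) < \<kappa> * h / 8"
    by (auto simp: dist_commute)
  have near: "dist (\<alpha> t) (\<alpha> c) \<le> \<kappa> * h / 8" if "t \<in> {?l..?r}" for t
  proof -
    have "dist (\<alpha> t) (\<alpha> c) \<le> (1 - \<epsilon>) * dist t c"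
      by (rule lipschitz_onD[OF \<alpha>_lip that c'(1)])
    also have "\<dots> \<le> 1 * len"
      using that c'(1) eps by (intro mult_mono) (auto simp: dist_real_def)
    finally show ?thesis
      using arc(5) \<delta>(2) by simp
  qed
  have gl: "norm (\<alpha> ?l - \<beta> ?l) \<le> \<kappa> * (?l - ?m)"
  proof -
    have "dist (\<alpha> x) (\<beta> x) \<le> \<kappa> * h / 8 + \<kappa> * h / 8"
      using near[of x] c'(2) ord dist_triangle[of "\<alpha> x" "\<beta> x" "\<alpha> c"] by simp
    then show ?thesis
      using \<kappa>h by (simp add: dist_norm)
  qed
  have gr: "norm (\<alpha> ?r - \<beta> ?r) \<le> \<kappa> * (?n - ?r)"
  proof -
    have "dist (\<beta> x) (\<beta> ?r) \<le> (1 - \<kappa>) * dist x ?r"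
      using ord by (intro lipschitz_onD[OF \<beta>_lip]) auto
    also have "\<dots> \<le> 1 * len"
      using eps arc(4) by (intro mult_mono) (auto simp: dist_real_def)
    finally have "dist (\<beta> x) (\<beta> ?r) \<le> \<kappa> * h / 8"
      using arc(5) \<delta>(2) by simp
    then have "dist (\<alpha> ?r) (\<beta> ?r) \<le> \<kappa> * h / 8 + \<kappa> * h / 8 + \<kappa> * h / 8"
      using near[of ?r] c'(2) ord dist_triangle[of "\<alpha> ?r" "\<beta> ?r" "\<alpha> c"]
        dist_triangle[of "\<alpha> c" "\<beta> ?r" "\<beta> x"] by simp
    also have "\<dots> \<le> \<kappa> * (h / 2)"
      using \<kappa>h by simp
    also have "\<dots> \<le> \<kappa> * (?n - ?r)"
      using eps arc(5) \<delta>(2) \<kappa>h by (intro mult_left_mono) auto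
    finally show ?thesis by (simp add: dist_norm)
  qed
  define g where "g = graft \<beta> \<alpha> ?m ?l ?r ?n"
  note g_simps = graft_simps[OF ord, of _ \<beta> \<alpha>, folded g_def]
  define r where "r = \<lparr>crv = g, lo = ?l, hi = ?r, mlo = ?m, mhi = ?n, vel = v', reg = V', core = P\<rparr>"
  have r: "crv r = g" "lo r = ?l" "hi r = ?r" "mlo r = ?m" "mhi r = ?n" "vel r = v'" "reg r = V'" "core r = P"
    by (simp_all add: r_def)
  have M01: "0 < ?m" "?n < 1"
  proof -
    have "?m \<in> {lo (f p)<..<hi (f p)}" "?n \<in> {lo (f p)<..<hi (f p)}"
      using h(1) by (intro subsetD[OF Mp]; simp)+
    then show "0 < ?m" "?n < 1"
      using bounds_p(1,2) by auto
  qed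
  have "node_ok S G (Suc n) r"
    unfolding node_ok_def r \<epsilon>_def[symmetric]
  proof (intro conjI)
    show "0 < ?m" "?m \<le> ?l" "?l < ?r" "?r \<le> ?n" "?n < 1" "compact P" "P \<subseteq> {?l<..<?r}" "0 < measure lebesgue P"
      using M01 ord P by auto
    show "?r - ?l \<le> (1 / 2) ^ Suc n"
      using arc(5) \<delta>(3) by simp
    show "g ` P \<subseteq> V' \<inter> S"
      using P(2,4) g_simps(1) by force
    show "stable_direction S V' v' \<epsilon>" by fact
    show "cball (g ?l) (?r - ?l) \<subseteq> G (Suc n)"
      using arc(13) ord by (simp add: g_simps(1) \<alpha>_def)
    show "(1 - \<epsilon>)-lipschitz_on {?l..?r} g"
      by (rule lipschitz_on_transform[OF \<alpha>_lip g_simps(1)])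
    show "(4 * \<epsilon>)-lipschitz_on {?l..?r} (\<lambda>t. g t - t *\<^sub>R v')"
      by (rule lipschitz_on_transform[OF \<alpha>_drift]) (simp add: g_simps(1))
    \<comment> \<open>Drift 0 turns the splicing lemma into the speed bound:
      \<open>1 - \<kappa>\<close> for the host arc plus slope \<open>\<kappa>\<close> of the ramps
      is exactly 1.\<close>
    have "1-lipschitz_on {0..1} (\<lambda>t. \<beta> t - t *\<^sub>R 0)" "(1 - \<kappa>)-lipschitz_on ?M (\<lambda>t. \<beta> t - t *\<^sub>R 0)"
      "1-lipschitz_on {?l..?r} (\<lambda>t. \<alpha> t - t *\<^sub>R 0)"
      using \<beta>_lip1 \<beta>_lip lipschitz_on_le[OF \<alpha>_lip, of 1] eps by simp_all
    from lipschitz_on_graft[OF less_imp_le[OF M01(1)] ord less_imp_le[OF M01(2)] this(1,2) _ this(3) gl gr]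
    have "1-lipschitz_on {0..1} (\<lambda>t. graft \<beta> \<alpha> ?m ?l ?r ?n t - t *\<^sub>R 0)"
      by simp
    then show "1-lipschitz_on {0..1} g"
      by (simp add: g_def)
    show "finite {t\<in>{0..1}. \<not> g differentiable (at t within {0..1})}"
      unfolding g_def
    proof (rule finite_not_differentiable_graft[OF ord])
      show "finite {t\<in>{0..1}. \<not> \<beta> differentiable (at t within {0..1})}"
        using node[of n] by (simp add: node_ok_def \<beta>_def)
      fix t assume t: "t \<in> {?l<..<?r}"
      then show "\<alpha> differentiable (at t)"
        unfolding \<alpha>_def[abs_def] by (rule differentiable_translate[OF arc(6)])
    qed
  qed
  moreover have "linked f (Suc n) r"
    unfolding linked_def r \<epsilon>_def[symmetric]
  proof (intro allI impI)
    fix j assume "j < Suc n"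
    then have jn: "j \<le> n" by simp
    \<comment> \<open>The last inequality concerns the host direction \<open>v\<close>: the ramps
      follow the old curve, so their distance from \<open>vel (f j)\<close> is at most
      \<open>4 * \<kappa>\<close> for the host drift, the change of direction from \<open>v\<close>,
      and \<open>\<kappa>\<close> for the slope.\<close>
    have nest: "?M \<inter> zone (f j) = {} \<or>
        ?M \<subseteq> {lo (f j)<..<hi (f j)} \<and> norm (v' - vel (f j)) + 8 * \<epsilon> \<le> 8 * tol j \<and>
        norm (v - vel (f j)) + 8 * \<kappa> \<le> 8 * tol j"
    proof -
      consider "j = p" | "p < j" | "j < p" by linarith
      then show ?thesis
      proof cases
        case 1
        then show ?thesis using Mp arc(3) eps by (simp add: v_def \<kappa>_def)
      next
        case 2
        then have "zone (f j) \<subseteq> Z" using jn by (auto simp: Z_def)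
        then show ?thesis using MZ by blast
      next
        case 3
        have Mzp: "?M \<subseteq> zone (f p)" using Mp bounds_p(3) by blast
        have "zone (f p) \<inter> zone (f j) = {} \<or>
          zone (f p) \<subseteq> {lo (f j)<..<hi (f j)} \<and> norm (v - vel (f j)) + 8 * \<kappa> \<le> 8 * tol j"
          using link[OF pn] 3 by (simp add: linked_def v_def \<kappa>_def)
        then show ?thesis
        proof
          assume "zone (f p) \<inter> zone (f j) = {}"
          then show ?thesis using Mzp by blast
        next
          assume *: "zone (f p) \<subseteq> {lo (f j)<..<hi (f j)} \<and> norm (v - vel (f j)) + 8 * \<kappa> \<le> 8 * tol j"
          have "norm (v' - vel (f j)) \<le> norm (v' - v) + norm (v - vel (f j))"
            using norm_triangle_ineq[of "v' - v" "v - vel (f j)"] by simp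
          then show ?thesis
            using * Mzp arc(3) eps by auto
        qed
      qed
    qed
    have old: "(8 * tol j)-lipschitz_on {lo (f j)..hi (f j)} (\<lambda>t. \<beta> t - t *\<^sub>R vel (f j))"
    proof (cases "j = n")
      case True
      have "(4 * tol n)-lipschitz_on {lo (f n)..hi (f n)} (\<lambda>t. \<beta> t - t *\<^sub>R vel (f n))"
        using node[of n] by (simp add: node_ok_def \<beta>_def)
      then show ?thesis
        unfolding True by (rule lipschitz_on_le) (use tol_pos[of n] in simp)
    next
      case False
      then show ?thesis
        using link[of n] jn by (simp add: linked_def \<beta>_def)
    qed
    have "(8 * tol j)-lipschitz_on {lo (f j)..hi (f j)} (\<lambda>t. g t - t *\<^sub>R vel (f j))"
      using nest
    proof
      assume disj: "?M \<inter> zone (f j) = {}"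
      have "g t = \<beta> t" if "t \<in> {lo (f j)..hi (f j)}" for t
      proof (rule g_simps(4))
        have "t \<in> zone (f j)" using that bounds[OF jn] by auto
        then show "t \<notin> {?m<..<?n}" using disj by auto
      qed
      then show ?thesis
        by (intro lipschitz_on_transform[OF old]) simp
    next
      assume *: "?M \<subseteq> {lo (f j)<..<hi (f j)} \<and> norm (v' - vel (f j)) + 8 * \<epsilon> \<le> 8 * tol j \<and>
        norm (v - vel (f j)) + 8 * \<kappa> \<le> 8 * tol j"
      have "?m \<in> ?M" "?n \<in> ?M" using h(1) by auto
      then have "?m \<in> {lo (f j)<..<hi (f j)}" "?n \<in> {lo (f j)<..<hi (f j)}"
        using * by blast+
      then have "lo (f j) \<le> ?m" "?n \<le> hi (f j)" by auto
      moreover have "4 * \<kappa> + norm (v - vel (f j)) + \<kappa> \<le> 8 * tol j" "4 * \<epsilon> + norm (v' - vel (f j)) \<le> 8 * tol j"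
        using * eps by auto
      ultimately show ?thesis
        unfolding g_def
        using lipschitz_on_graft[OF _ ord _ old lipschitz_on_change_drift[OF \<beta>_drift, of "vel (f j)"] _
            lipschitz_on_le[OF lipschitz_on_change_drift[OF \<alpha>_drift, of "vel (f j)"]] gl gr]
        by blast
    qed
    moreover have "(?n - ?m) * 2 ^ Suc (Suc n) \<le> measure lebesgue (core (f j))"
      using h(4) \<mu>[OF jn] by simp
    ultimately show "(?M \<inter> zone (f j) = {} \<or>
        ?M \<subseteq> {lo (f j)<..<hi (f j)} \<and> norm (v' - vel (f j)) + 8 * \<epsilon> \<le> 8 * tol j) \<and>
       (8 * tol j)-lipschitz_on {lo (f j)..hi (f j)} (\<lambda>t. g t - t *\<^sub>R vel (f j)) \<and>
       (?n - ?m) * 2 ^ Suc (Suc n) \<le> measure lebesgue (core (f j))"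
      using nest by blast
  qed
  moreover have "refines B f n r"
    unfolding refines_def r pi prod.case Z_def[symmetric]
  proof (intro conjI allI impI)
    fix t assume "t \<notin> {?m<..<?n}"
    then show "g t = crv (f n) t"
      by (simp add: g_simps(4) \<beta>_def)
  next
    show "?n - ?m \<le> (1 / 8) ^ n"
      using h(3) by simp
    show "?M \<subseteq> zone (f p)"
      using Mp bounds_p(3) by blast
    assume "core (f p) \<inter> B i - Z \<noteq> {}"
    then show "?M \<subseteq> B i"
      using M by (auto simp: W_def)
  qed
  ultimately show ?thesis by blast
qed

subsection \<open>The limit curve\<close>

locale node_sequence =
  fixes S :: "'a::euclidean_space set" and G :: "nat \<Rightarrow> 'a set" and B :: "nat \<Rightarrow> real set"
    and f :: "nat \<Rightarrow> 'a node"
  assumes node: "node_ok S G k (f k)"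
    and link: "linked f k (f k)"
    and refine: "refines B f n (f (Suc n))"
    and base: "open U \<Longrightarrow> x \<in> U \<Longrightarrow> \<exists>i. x \<in> B i \<and> B i \<subseteq> U"
    and S: "closed S"
    and decseq_G: "decseq G"
begin

lemma node_bounds:
  "0 < mlo (f k)" "mlo (f k) \<le> lo (f k)" "lo (f k) < hi (f k)" "hi (f k) \<le> mhi (f k)" "mhi (f k) < 1"
  "hi (f k) - lo (f k) \<le> (1 / 2) ^ k"
  using node[of k] by (auto simp: node_ok_def)

lemma node_core:
  "compact (core (f k))" "core (f k) \<subseteq> {lo (f k)<..<hi (f k)}" "0 < measure lebesgue (core (f k))"
  "crv (f k) ` core (f k) \<subseteq> S"
  using node[of k] by (auto simp: node_ok_def)

lemma node_lipschitz: "1-lipschitz_on {0..1} (crv (f k))"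
  using node[of k] by (auto simp: node_ok_def)

lemma node_unit_vel: "norm (vel (f k)) = 1"
  using node[of k] by (auto simp: node_ok_def stable_direction_def)

lemma zone_nested: "j < k \<Longrightarrow> zone (f k) \<inter> zone (f j) = {} \<or> zone (f k) \<subseteq> {lo (f j)<..<hi (f j)}"
  using link[of k] by (auto simp: linked_def)

lemma crv_Suc_eq: "t \<notin> {mlo (f (Suc n))<..<mhi (f (Suc n))} \<Longrightarrow> crv (f (Suc n)) t = crv (f n) t"
  using refine[of n] by (auto simp: refines_def)

lemma zone_length: "mhi (f (Suc n)) - mlo (f (Suc n)) \<le> (1 / 8) ^ n"
  using refine[of n] by (auto simp: refines_def)

text \<open>Both curves are 1-Lipschitz and agree at the left end of the modified zone.\<close>

lemma norm_crv_Suc_diff_le: "norm (crv (f (Suc n)) t - crv (f n) t) \<le> 2 * (1 / 8) ^ n"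
proof (cases "t \<in> {mlo (f (Suc n))<..<mhi (f (Suc n))}")
  case False
  then show ?thesis by (simp add: crv_Suc_eq)
next
  case True
  let ?m = "mlo (f (Suc n))"
  have t: "t \<in> {0..1}" "?m \<in> {0..1}" "\<bar>t - ?m\<bar> \<le> (1 / 8) ^ n"
    using True node_bounds[of "Suc n"] zone_length[of n] by auto
  have "norm (crv (f k) t - crv (f k) ?m) \<le> (1 / 8) ^ n" for k
    using lipschitz_on_normD[OF node_lipschitz[of k] t(1,2)] t(3) by simp
  from this[of "Suc n"] this[of n] have "norm (crv (f (Suc n)) t - crv (f (Suc n)) ?m) \<le> (1 / 8) ^ n"
    "norm (crv (f n) t - crv (f n) ?m) \<le> (1 / 8) ^ n" .
  moreover have "crv (f (Suc n)) ?m = crv (f n) ?m"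
    by (simp add: crv_Suc_eq)
  moreover have "crv (f (Suc n)) t - crv (f n) t =
      (crv (f (Suc n)) t - crv (f (Suc n)) ?m) - (crv (f n) t - crv (f n) ?m)"
    using \<open>crv (f (Suc n)) ?m = crv (f n) ?m\<close> by simp
  ultimately show ?thesis
    using norm_triangle_ineq4[of "crv (f (Suc n)) t - crv (f (Suc n)) ?m" "crv (f n) t - crv (f n) ?m"]
    by simp
qed

definition \<gamma> :: "real \<Rightarrow> 'a" where "\<gamma> t = lim (\<lambda>n. crv (f n) t)"

lemma crv_tendsto: "(\<lambda>n. crv (f n) t) \<longlonglongrightarrow> \<gamma> t"
proof -
  have "summable (\<lambda>n. crv (f (Suc n)) t - crv (f n) t)"
  proof (rule summable_comparison_test)
    show "\<exists>N. \<forall>n\<ge>N. norm (crv (f (Suc n)) t - crv (f n) t) \<le> 2 * (1 / 8) ^ n"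
      using norm_crv_Suc_diff_le by blast
    show "summable (\<lambda>n. 2 * (1 / 8 :: real) ^ n)"
      by (intro summable_mult summable_geometric) auto
  qed
  then have "convergent (\<lambda>n. \<Sum>i<n. crv (f (Suc i)) t - crv (f i) t)"
    by (simp add: summable_iff_convergent)
  then have "convergent (\<lambda>n. crv (f n) t - crv (f 0) t)"
    using sum_lessThan_telescope[of "\<lambda>i. crv (f i) t"] by simp
  then have "convergent (\<lambda>n. crv (f n) t)"
    by (simp add: convergent_diff_const_right_iff)
  then show ?thesis
    unfolding \<gamma>_def by (simp add: convergent_LIMSEQ_iff)
qed

lemma \<gamma>_eq_of_notin_zones:
  assumes "\<And>j. j > k \<Longrightarrow> t \<notin> {mlo (f j)<..<mhi (f j)}"
  shows "\<gamma> t = crv (f k) t"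
proof -
  have "crv (f n) t = crv (f k) t" if "k \<le> n" for n
    using that
  proof (induction n rule: dec_induct)
    case (step n)
    then show ?case using crv_Suc_eq[of t n] assms[of "Suc n"] by simp
  qed simp
  then have "(\<lambda>n. crv (f n) t) \<longlonglongrightarrow> crv (f k) t"
    by (intro tendsto_eventually eventually_sequentiallyI[of k])
  then show ?thesis
    using crv_tendsto LIMSEQ_unique by blast
qed

text \<open>A later zone either misses the zone of \<open>k\<close> or lies strictly inside its arc,
  so the starting point of an arc never moves again.\<close>

lemma \<gamma>_lo: "\<gamma> (lo (f k)) = crv (f k) (lo (f k))"
proof (rule \<gamma>_eq_of_notin_zones)
  fix j assume "k < j"
  show "lo (f k) \<notin> {mlo (f j)<..<mhi (f j)}"
    using zone_nested[OF \<open>k < j\<close>] node_bounds[of k] node_bounds[of j] by force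
qed

lemma \<gamma>_lipschitz: "1-lipschitz_on {0..1} \<gamma>"
  using node_lipschitz crv_tendsto by (rule lipschitz_on_pointwise_limit[of 0])

lemma \<gamma>_drift_lipschitz: "(8 * tol k)-lipschitz_on {lo (f k)..hi (f k)} (\<lambda>t. \<gamma> t - t *\<^sub>R vel (f k))"
proof (rule lipschitz_on_pointwise_limit[where N = "Suc k"])
  fix n assume "Suc k \<le> n"
  then show "(8 * tol k)-lipschitz_on {lo (f k)..hi (f k)} (\<lambda>t. crv (f n) t - t *\<^sub>R vel (f k))"
    using link[of n] by (auto simp: linked_def)
next
  fix t show "(\<lambda>n. crv (f n) t - t *\<^sub>R vel (f k)) \<longlonglongrightarrow> \<gamma> t - t *\<^sub>R vel (f k)"
    by (intro tendsto_intros crv_tendsto)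
qed

lemma \<gamma>_mem_cball:
  assumes "t \<in> {lo (f k)..hi (f k)}"
  shows "\<gamma> t \<in> cball (crv (f k) (lo (f k))) (hi (f k) - lo (f k))"
proof -
  have "dist (\<gamma> t) (\<gamma> (lo (f k))) \<le> 1 * dist t (lo (f k))"
    using assms node_bounds[of k] by (intro lipschitz_onD[OF \<gamma>_lipschitz]) auto
  then show ?thesis
    using assms by (auto simp: \<gamma>_lo dist_commute dist_real_def)
qed

lemma \<gamma>_mem_G: "t \<in> {lo (f k)..hi (f k)} \<Longrightarrow> \<gamma> t \<in> G k"
  using \<gamma>_mem_cball[of t k] node[of k] by (auto simp: node_ok_def)

lemma core_nonempty: obtains c where "c \<in> core (f k)"
  using node_core(3)[of k] by (metis all_not_in_conv less_irrefl measure_empty)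

text \<open>Later grafts may push core times off \<open>S\<close>, so the witness is a point of the
  stage \<open>k\<close> curve at a core time, compared with the limit through the common starting
  point.\<close>

lemma \<gamma>_near_S:
  assumes "t \<in> {lo (f k)..hi (f k)}"
  obtains y where "y \<in> S" "dist (\<gamma> t) y \<le> 2 * (1 / 2) ^ k"
proof -
  obtain c where c: "c \<in> core (f k)" by (rule core_nonempty)
  then have c': "c \<in> {lo (f k)..hi (f k)}" using node_core(2)[of k] by auto
  have "dist (crv (f k) c) (crv (f k) (lo (f k))) \<le> 1 * dist c (lo (f k))"
    using c' node_bounds[of k] by (intro lipschitz_onD[OF node_lipschitz]) auto
  then have "dist (crv (f k) c) (crv (f k) (lo (f k))) \<le> hi (f k) - lo (f k)"
    using c' by (auto simp: dist_real_def)
  moreover have "dist (crv (f k) (lo (f k))) (\<gamma> t) \<le> hi (f k) - lo (f k)"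
    using \<gamma>_mem_cball[OF assms] by simp
  ultimately have "dist (\<gamma> t) (crv (f k) c) \<le> 2 * (1 / 2) ^ k"
    using node_bounds(6)[of k] dist_triangle[of "\<gamma> t" "crv (f k) c" "crv (f k) (lo (f k))"]
    by (simp add: dist_commute)
  then show thesis
    using that c node_core(4)[of k] by blast
qed

section \<open>Times lying in infinitely many arcs\<close>

definition deep :: "real set" where
  "deep = (\<Inter>n. \<Union>k\<in>{n..}. {lo (f k)<..<hi (f k)})"

lemma deepD: assumes "t \<in> deep" obtains k where "n \<le> k" "t \<in> {lo (f k)<..<hi (f k)}"
  using assms by (fastforce simp: deep_def)

lemma deep_\<gamma>_mem_S:
  assumes "t \<in> deep" shows "\<gamma> t \<in> S"
proof -
  have "\<exists>y\<in>S. dist y (\<gamma> t) < e" if e: "0 < e" for e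
  proof -
    obtain n where n: "(1 / 2) ^ n < e / (2 :: real)"
      using real_arch_pow_inv[OF half_gt_zero[OF e], of "1 / 2"] by auto
    obtain k where k: "n \<le> k" "t \<in> {lo (f k)<..<hi (f k)}"
      using assms by (rule deepD)
    obtain y where "y \<in> S" "dist (\<gamma> t) y \<le> 2 * (1 / 2) ^ k"
      using \<gamma>_near_S[of t k] k by auto
    moreover have "(1 / 2 :: real) ^ k \<le> (1 / 2) ^ n"
      using k(1) by (intro power_decreasing) auto
    ultimately have "dist (\<gamma> t) y < e"
      using n by linarith
    then show ?thesis
      using \<open>y \<in> S\<close> by (metis dist_commute)
  qed
  then show ?thesis
    using S by (metis closed_approachable)
qed

lemma deep_\<gamma>_mem_G:
  assumes "t \<in> deep" shows "\<gamma> t \<in> G n"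
proof -
  obtain k where k: "n \<le> k" "t \<in> {lo (f k)<..<hi (f k)}"
    using assms by (rule deepD)
  then have "\<gamma> t \<in> G k" by (intro \<gamma>_mem_G) auto
  then show ?thesis
    using decseq_G k(1) by (auto simp: decseq_def)
qed

text \<open>Both velocities approximate the same increment of the limit curve just after
  \<open>t\<close>, so they are close before any derivative is known to exist.\<close>

lemma deep_vel_diff_le:
  assumes "t \<in> {lo (f k)<..<hi (f k)}" "t \<in> {lo (f j)<..<hi (f j)}"
  shows "norm (vel (f k) - vel (f j)) \<le> 8 * tol k + 8 * tol j"
proof -
  let ?J = "\<lambda>k. {lo (f k)..hi (f k)}"
  define h where "h = min (hi (f k) - t) (hi (f j) - t)"
  have h: "0 < h" "t \<in> ?J k" "t + h \<in> ?J k" "t \<in> ?J j" "t + h \<in> ?J j"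
    using assms by (auto simp: h_def)
  let ?d = "\<gamma> (t + h) - \<gamma> t"
  have "norm (?d - h *\<^sub>R vel (f k)) \<le> 8 * tol k * h"
    using lipschitz_on_normD[OF \<gamma>_drift_lipschitz h(3,2)] h(1) by (simp add: algebra_simps)
  moreover have "norm (?d - h *\<^sub>R vel (f j)) \<le> 8 * tol j * h"
    using lipschitz_on_normD[OF \<gamma>_drift_lipschitz h(5,4)] h(1) by (simp add: algebra_simps)
  moreover have eq: "h *\<^sub>R (vel (f k) - vel (f j)) = (?d - h *\<^sub>R vel (f j)) - (?d - h *\<^sub>R vel (f k))"
    by (simp add: algebra_simps)
  ultimately have "norm (h *\<^sub>R (vel (f k) - vel (f j))) \<le> 8 * tol j * h + 8 * tol k * h"
    using norm_triangle_ineq4[of "?d - h *\<^sub>R vel (f j)" "?d - h *\<^sub>R vel (f k)"]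
    unfolding eq by linarith
  then have "h * norm (vel (f k) - vel (f j)) \<le> h * (8 * tol k + 8 * tol j)"
    using h(1) by (simp add: distrib_left mult.commute add.commute)
  then show ?thesis
    using h(1) by simp
qed

text \<open>The velocities of the arcs around \<open>t\<close> form a Cauchy sequence of unit
  vectors. On each arc the limit curve drifts from its velocity by a Lipschitz constant tending to
  0, so the limit vector is the derivative.\<close>

lemma deep_has_vector_derivative:
  assumes t: "t \<in> deep"
  obtains v where "(\<gamma> has_vector_derivative v) (at t)" "norm v = 1"
proof -
  have "\<forall>n. \<exists>k\<ge>n. t \<in> {lo (f k)<..<hi (f k)}"
    using deepD[OF t] by metis
  then obtain q where q: "\<And>n. n \<le> q n" "\<And>n. t \<in> {lo (f (q n))<..<hi (f (q n))}"
    by metis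
  have q0: "(\<lambda>n. tol (q n)) \<longlonglongrightarrow> 0"
  proof (rule tendsto_sandwich[OF _ _ tendsto_const tol_tendsto_0])
    show "\<forall>\<^sub>F n in sequentially. 0 \<le> tol (q n)"
      using tol_pos by (simp add: less_imp_le)
    show "\<forall>\<^sub>F n in sequentially. tol (q n) \<le> tol n"
      using tol_mono q(1) by simp
  qed
  have "Cauchy (\<lambda>n. vel (f (q n)))"
    unfolding Cauchy_def
  proof (intro allI impI)
    fix e :: real assume "0 < e"
    then obtain N where N: "\<And>n. n \<ge> N \<Longrightarrow> tol (q n) < e / 16"
      using LIMSEQ_D[OF q0, of "e / 16"] tol_pos by (auto simp: abs_of_pos)
    have "dist (vel (f (q m))) (vel (f (q n))) < e" if "m \<ge> N" "n \<ge> N" for m n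
      using deep_vel_diff_le[OF q(2)[of m] q(2)[of n]] N[OF that(1)] N[OF that(2)]
      by (simp add: dist_norm)
    then show "\<exists>N. \<forall>m\<ge>N. \<forall>n\<ge>N. dist (vel (f (q m))) (vel (f (q n))) < e" by blast
  qed
  then obtain v where v: "(\<lambda>n. vel (f (q n))) \<longlonglongrightarrow> v"
    using Cauchy_convergent convergent_def by blast
  have "norm v = 1"
    using tendsto_norm[OF v] by (simp add: node_unit_vel LIMSEQ_const_iff)
  have "(\<gamma> has_vector_derivative v) (at t)"
    unfolding has_vector_derivative_def has_derivative_at_alt
  proof (intro conjI allI impI)
    fix e :: real assume "0 < e"
    have "\<forall>\<^sub>F n in sequentially. tol (q n) < e / 16"
      using order_tendstoD(2)[OF q0, of "e / 16"] \<open>0 < e\<close> by simp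
    moreover have "\<forall>\<^sub>F n in sequentially. dist (vel (f (q n))) v < e / 2"
      by (rule tendstoD[OF v half_gt_zero[OF \<open>0 < e\<close>]])
    ultimately have "\<forall>\<^sub>F n in sequentially. tol (q n) < e / 16 \<and> dist (vel (f (q n))) v < e / 2"
      by (rule eventually_conj)
    then obtain n where n: "tol (q n) < e / 16" "dist (vel (f (q n))) v < e / 2"
      using eventually_happens'[OF sequentially_bot] by blast
    let ?k = "q n"
    define d where "d = min (t - lo (f ?k)) (hi (f ?k) - t)"
    have "0 < d" using q(2)[of n] by (auto simp: d_def)
    moreover have "norm (\<gamma> y - \<gamma> t - (y - t) *\<^sub>R v) \<le> e * norm (y - t)" if "norm (y - t) < d" for y
    proof -
      have y: "y \<in> {lo (f ?k)..hi (f ?k)}" "t \<in> {lo (f ?k)..hi (f ?k)}"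
        using that q(2)[of n] by (auto simp: d_def)
      let ?a = "\<gamma> y - \<gamma> t - (y - t) *\<^sub>R vel (f ?k)" and ?b = "(y - t) *\<^sub>R (vel (f ?k) - v)"
      have "norm ?a \<le> 8 * tol ?k * \<bar>y - t\<bar>"
        using lipschitz_on_normD[OF \<gamma>_drift_lipschitz y] by (simp add: algebra_simps)
      also have "\<dots> \<le> e / 2 * \<bar>y - t\<bar>"
        using n(1) by (intro mult_right_mono) auto
      finally have a: "norm ?a \<le> e / 2 * \<bar>y - t\<bar>" .
      have b: "norm ?b \<le> e / 2 * \<bar>y - t\<bar>"
        using mult_right_mono[OF less_imp_le[OF n(2)], of "\<bar>y - t\<bar>"]
        by (simp add: dist_norm mult.commute)
      have "\<gamma> y - \<gamma> t - (y - t) *\<^sub>R v = ?a + ?b"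
        by (simp add: algebra_simps)
      then have "norm (\<gamma> y - \<gamma> t - (y - t) *\<^sub>R v) \<le> norm ?a + norm ?b"
        by (metis norm_triangle_ineq)
      also have "\<dots> \<le> e * norm (y - t)"
        using a b by simp
      finally show ?thesis .
    qed
    ultimately show "\<exists>d>0. \<forall>y. norm (y - t) < d \<longrightarrow> norm (\<gamma> y - \<gamma> t - (y - t) *\<^sub>R v) \<le> e * norm (y - t)"
      by blast
  qed (simp add: bounded_linear_scaleR_left)
  then show thesis using that \<open>norm v = 1\<close> by blast
qed

section \<open>Behaviour off the root arc and almost everywhere\<close>

lemma zone_subset_zone_0: "zone (f k) \<subseteq> zone (f 0)"
proof (induction k rule: less_induct)
  case (less k)
  show ?case
  proof (cases k)
    case (Suc n)
    obtain p i where pi: "prod_decode n = (p, i)" by force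
    then have "p \<le> n"
      by (metis le_prod_encode_1 prod_decode_inverse)
    moreover have "zone (f k) \<subseteq> zone (f p)"
      using refine[of n] pi by (simp add: refines_def Suc)
    ultimately show ?thesis
      using less.IH[of p] Suc by (metis le_imp_less_Suc subset_trans)
  qed simp
qed

lemma \<gamma>_eq_outside: "t \<notin> {mlo (f 0)<..<mhi (f 0)} \<Longrightarrow> \<gamma> t = crv (f 0) t"
proof (rule \<gamma>_eq_of_notin_zones)
  fix j :: nat assume "t \<notin> {mlo (f 0)<..<mhi (f 0)}" "0 < j"
  then show "t \<notin> {mlo (f j)<..<mhi (f j)}"
    using zone_subset_zone_0[of j] node_bounds[of j] by (auto simp: atLeastatMost_subset_iff)
qed

text \<open>
  A change made at distance at least $2^{-n}$ from $t$ has size at most $2 \cdot 8^{-n}$. By Borel--Cantelli almost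
  every $t$ is that far from all but finitely many changes, so Rademacher's theorem is not needed for \<open>\<gamma>\<close>.
\<close>

lemma quadratic_approximation:
  assumes far: "\<And>n. n \<ge> K \<Longrightarrow> t \<notin> {mlo (f (Suc n)) - (1 / 2) ^ n..mhi (f (Suc n)) + (1 / 2) ^ n}"
  shows "norm (\<gamma> s - crv (f K) s) \<le> 4 * (s - t)\<^sup>2"
proof -
  have step: "norm (crv (f (Suc n)) s - crv (f n) s) \<le> 2 * (1 / 2) ^ n * (s - t)\<^sup>2" if "K \<le> n" for n
  proof (cases "s \<in> {mlo (f (Suc n))<..<mhi (f (Suc n))}")
    case False
    then show ?thesis by (simp add: crv_Suc_eq)
  next
    case True
    then have "(1 / 2) ^ n \<le> \<bar>s - t\<bar>"
      using far[OF that] by auto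
    then have "((1 / 2) ^ n)\<^sup>2 \<le> \<bar>s - t\<bar>\<^sup>2"
      by (intro power_mono) auto
    then have "2 * (1 / 2) ^ n * ((1 / 2) ^ n)\<^sup>2 \<le> 2 * (1 / 2) ^ n * (s - t)\<^sup>2"
      by (intro mult_left_mono) auto
    moreover have "2 * (1 / 2) ^ n * ((1 / 2) ^ n)\<^sup>2 = (2 * (1 / 8) ^ n :: real)"
      by (simp add: power2_eq_square flip: power_mult_distrib)
    ultimately show ?thesis
      using norm_crv_Suc_diff_le[of n s] by linarith
  qed
  \<comment> \<open>The steps from \<open>K\<close> to \<open>n\<close> sum to at most a partial
    geometric series; \<open>4 - 4 * (1 / 2) ^ n\<close> is its value from index 0, chosen so that
    the induction closes exactly.\<close>
  have bd: "norm (crv (f n) s - crv (f K) s) \<le> (4 - 4 * (1 / 2) ^ n) * (s - t)\<^sup>2" if "K \<le> n" for n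
    using that
  proof (induction n rule: dec_induct)
    case base
    have "0 \<le> 4 - 4 * (1 / 2 :: real) ^ K" by (simp add: power_le_one)
    then show ?case by simp
  next
    case (step n)
    have "norm (crv (f (Suc n)) s - crv (f K) s) \<le>
        norm (crv (f (Suc n)) s - crv (f n) s) + norm (crv (f n) s - crv (f K) s)"
      using norm_triangle_ineq[of "crv (f (Suc n)) s - crv (f n) s" "crv (f n) s - crv (f K) s"] by simp
    also have "\<dots> \<le> 2 * (1 / 2) ^ n * (s - t)\<^sup>2 + (4 - 4 * (1 / 2) ^ n) * (s - t)\<^sup>2"
      using step \<open>\<And>n. K \<le> n \<Longrightarrow> norm (crv (f (Suc n)) s - crv (f n) s) \<le> _\<close> by (intro add_mono) auto
    also have "\<dots> = (4 - 4 * (1 / 2) ^ Suc n) * (s - t)\<^sup>2"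
      by (simp add: algebra_simps)
    finally show ?case .
  qed
  have "norm (crv (f n) s - crv (f K) s) \<le> 4 * (s - t)\<^sup>2" if "K \<le> n" for n
    by (rule order_trans[OF bd[OF that]]) (auto intro!: mult_right_mono)
  moreover have "(\<lambda>n. norm (crv (f n) s - crv (f K) s)) \<longlonglongrightarrow> norm (\<gamma> s - crv (f K) s)"
    by (intro tendsto_intros crv_tendsto)
  ultimately show ?thesis
    by (meson LIMSEQ_le_const2)
qed

lemma AE_\<gamma>_differentiable:
  "AE t in lebesgue. t \<in> {0..1} \<longrightarrow> (\<exists>v. (\<gamma> has_vector_derivative v) (at t within {0..1}))"
proof -
  define A where "A n = {mlo (f (Suc n)) - (1 / 2) ^ n..mhi (f (Suc n)) + (1 / 2) ^ n}" for n
  define X where "X = (\<Union>k. {t\<in>{0..1}. \<not> crv (f k) differentiable (at t within {0..1})})"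
  have "AE t in lebesgue. eventually (\<lambda>n. t \<in> space lebesgue - A n) sequentially"
  proof (rule borel_cantelli_AE1)
    show "A n \<in> sets lebesgue" "emeasure lebesgue (A n) < \<infinity>" for n
      by (auto simp: A_def emeasure_lborel_Icc_eq)
    have le: "measure lebesgue (A n) \<le> 3 * (1 / 2) ^ n" for n
    proof -
      have "measure lebesgue (A n) = mhi (f (Suc n)) - mlo (f (Suc n)) + 2 * (1 / 2) ^ n"
        using node_bounds[of "Suc n"] by (simp add: A_def)
      also have "\<dots> \<le> (1 / 8) ^ n + 2 * (1 / 2) ^ n"
        using zone_length by simp
      also have "(1 / 8 :: real) ^ n \<le> (1 / 2) ^ n"
        by (intro power_mono) auto
      finally show ?thesis by simp
    qed
    have "summable (\<lambda>n. 3 * (1 / 2 :: real) ^ n)"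
      by (intro summable_mult summable_geometric) auto
    then show "summable (\<lambda>n. measure lebesgue (A n))"
      by (rule summable_comparison_test'[where N = 0]) (use le in simp)
  qed
  moreover have "countable X"
    unfolding X_def using node by (intro countable_UN) (auto simp: node_ok_def intro: countable_finite)
  then have "X \<in> null_sets lebesgue"
    using countable_imp_null_set_lborel null_sets_completionI by blast
  then have "AE t in lebesgue. t \<notin> X"
    by (rule AE_not_in)
  ultimately show ?thesis
  proof eventually_elim
    case (elim t)
    then obtain K where K: "\<And>n. n \<ge> K \<Longrightarrow> t \<notin> A n"
      by (auto simp: eventually_sequentially)
    show ?case
    proof
      assume "t \<in> {0..1}"
      then have "crv (f K) differentiable (at t within {0..1})"
        using elim(2) by (auto simp: X_def)
      then obtain v where v: "(crv (f K) has_vector_derivative v) (at t within {0..1})"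
        using vector_derivative_works by blast
      have "((\<lambda>s. \<gamma> s - crv (f K) s) has_vector_derivative 0) (at t within {0..1})"
        using quadratic_approximation[of K t] K
        by (intro has_vector_derivative_zero_quadratic[where C = 4]) (auto simp: A_def)
      from has_vector_derivative_add[OF v this]
      have "(\<gamma> has_vector_derivative v) (at t within {0..1})"
        by simp
      then show "\<exists>v. (\<gamma> has_vector_derivative v) (at t within {0..1})" ..
    qed
  qed
qed

text \<open>The constant 0 means that both tails are straight with velocity \<open>w\<close>; on the
  root arc the velocity is within 1/4 of a unit vector.\<close>

lemma lipschitz_curve_\<gamma>:
  assumes root: "mlo (f 0) = lo (f 0)" "mhi (f 0) = hi (f 0)" and w: "w \<noteq> 0"
    and left: "0-lipschitz_on {0..lo (f 0)} (\<lambda>t. crv (f 0) t - t *\<^sub>R w)"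
    and right: "0-lipschitz_on {hi (f 0)..1} (\<lambda>t. crv (f 0) t - t *\<^sub>R w)"
  shows "lipschitz_curve 0 1 \<gamma>"
proof -
  let ?l = "lo (f 0)" and ?h = "hi (f 0)"
  have b: "0 < ?l" "?l < ?h" "?h < 1"
    using node_bounds[of 0] by auto
  have left': "0-lipschitz_on {0..?l} (\<lambda>t. \<gamma> t - t *\<^sub>R w)"
    and right': "0-lipschitz_on {?h..1} (\<lambda>t. \<gamma> t - t *\<^sub>R w)"
    by (rule lipschitz_on_transform[OF left], simp add: root \<gamma>_eq_outside)
      (rule lipschitz_on_transform[OF right], simp add: root \<gamma>_eq_outside)
  define c where "c = min (norm w) (3 / 4)"
  have "0 < c" using w by (simp add: c_def)
  have "{0, ?l, ?h, 1} \<in> null_sets lebesgue"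
    by (simp add: flip: negligible_iff_null_sets)
  from AE_not_in[OF this] AE_\<gamma>_differentiable
  have "AE t in lebesgue. t \<in> {0..1} \<longrightarrow> (\<exists>v. (\<gamma> has_vector_derivative v) (at t within {0..1}) \<and> c \<le> norm v)"
  proof eventually_elim
    case (elim t)
    show ?case
    proof
      assume t: "t \<in> {0..1}"
      with elim(2) obtain v where v: "(\<gamma> has_vector_derivative v) (at t within {0..1})" by blast
      consider "t \<in> {0<..<?l}" | "t \<in> {?l<..<?h}" | "t \<in> {?h<..<1}"
        using t elim(1) by fastforce
      then have "c \<le> norm v"
      proof cases
        case 1
        then have "norm (v - w) \<le> 0"
          using b by (intro norm_vector_derivative_diff_le[OF left' _ _ v]) auto
        then show ?thesis by (simp add: c_def)
      next
        case 2
        then have "norm (v - vel (f 0)) \<le> 8 * tol 0"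
          using b by (intro norm_vector_derivative_diff_le[OF \<gamma>_drift_lipschitz _ _ v]) auto
        then have "3 / 4 \<le> norm v"
          using norm_triangle_ineq2[of "vel (f 0)" v] node_unit_vel[of 0]
          by (simp add: tol_def norm_minus_commute)
        then show ?thesis by (simp add: c_def)
      next
        case 3
        then have "norm (v - w) \<le> 0"
          using b by (intro norm_vector_derivative_diff_le[OF right' _ _ v]) auto
        then show ?thesis by (simp add: c_def)
      qed
      with v show "\<exists>v. (\<gamma> has_vector_derivative v) (at t within {0..1}) \<and> c \<le> norm v" by blast
    qed
  qed
  then have "AE t in lebesgue_on {0..1}. \<exists>v. (\<gamma> has_vector_derivative v) (at t within {0..1}) \<and> c \<le> norm v"
    by (subst AE_restrict_space_iff) auto
  then show ?thesis
    unfolding lipschitz_curve_def using \<gamma>_lipschitz \<open>0 < c\<close> by auto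
qed

text \<open>Near \<open>t\<close> the derivative lies almost everywhere within
  \<open>8 * tol k\<close> of \<open>vel (f k)\<close>, for each of the infinitely many arcs
  \<open>k\<close> around \<open>t\<close>.\<close>

lemma deep_osc_tendsto_0:
  assumes t: "t \<in> deep"
  shows "((\<lambda>\<delta>. osc (\<lambda>s. vector_derivative \<gamma> (at s within {0..1})) ({t-\<delta>..t+\<delta>} \<inter> {0..1})) \<longlongrightarrow> 0) (at_right 0)"
proof -
  let ?g = "\<lambda>s. vector_derivative \<gamma> (at s within {0..1})"
  let ?U = "\<lambda>\<delta>. {t-\<delta>..t+\<delta>} \<inter> {0..1}"
  have small: "\<forall>\<^sub>F \<delta> in at_right 0. 0 \<le> osc ?g (?U \<delta>) \<and> osc ?g (?U \<delta>) \<le> ereal (16 * tol k)"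
    if k: "t \<in> {lo (f k)<..<hi (f k)}" for k
  proof -
    define d where "d = min (t - lo (f k)) (hi (f k) - t)"
    have "0 < d" using k by (auto simp: d_def)
    have "0 \<le> osc ?g (?U \<delta>) \<and> osc ?g (?U \<delta>) \<le> ereal (16 * tol k)" if \<delta>: "0 < \<delta>" "\<delta> < d" for \<delta>
    proof -
      have sub: "{t-\<delta>..t+\<delta>} \<subseteq> {lo (f k)<..<hi (f k)}"
        using \<delta> by (auto simp: d_def)
      have U: "?U \<delta> = {t-\<delta>..t+\<delta>}"
        using sub node_bounds[of k] by fastforce
      have "AE s in lebesgue. s \<in> ?U \<delta> \<longrightarrow> norm (?g s - vel (f k)) \<le> 8 * tol k"
        using AE_\<gamma>_differentiable
      proof eventually_elim
        case (elim s)
        show ?case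
        proof
          assume s: "s \<in> ?U \<delta>"
          then obtain v where v: "(\<gamma> has_vector_derivative v) (at s within {0..1})"
            using elim by auto
          then have "?g s = v"
            using s by (intro vector_derivative_within_closed_interval) auto
          moreover have "norm (v - vel (f k)) \<le> 8 * tol k"
            using s sub node_bounds[of k]
            by (intro norm_vector_derivative_diff_le[OF \<gamma>_drift_lipschitz _ _ v]) auto
          ultimately show "norm (?g s - vel (f k)) \<le> 8 * tol k" by simp
        qed
      qed
      then have "AE s in lebesgue_on (?U \<delta>). norm (?g s - vel (f k)) \<le> 8 * tol k"
        by (subst AE_restrict_space_iff) (auto simp: U)
      then have "osc ?g (?U \<delta>) \<le> ereal (2 * (8 * tol k))"
        by (intro osc_le) (auto simp: U)
      moreover have "0 \<le> osc ?g (?U \<delta>)"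
        unfolding U using \<delta> by (intro osc_nonneg) (auto simp: emeasure_lborel_Icc_eq)
      ultimately show ?thesis by simp
    qed
    then show ?thesis
      using \<open>0 < d\<close> by (auto simp: eventually_at_right_field)
  qed
  obtain k0 where k0: "t \<in> {lo (f k0)<..<hi (f k0)}"
    using t by (rule deepD)
  show ?thesis
  proof (rule order_tendstoI)
    fix a :: ereal assume "a < 0"
    show "\<forall>\<^sub>F \<delta> in at_right 0. a < osc ?g (?U \<delta>)"
      using small[OF k0] by eventually_elim (use \<open>a < 0\<close> in auto)
  next
    fix a :: ereal assume "0 < a"
    then obtain r where r: "0 < ereal r" "ereal r < a"
      using ereal_dense2 by blast
    then have "\<forall>\<^sub>F n in sequentially. tol n < r / 16"
      using order_tendstoD(2)[OF tol_tendsto_0, of "r / 16"] by simp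
    then obtain n where n: "\<And>k. k \<ge> n \<Longrightarrow> tol k < r / 16"
      by (auto simp: eventually_sequentially)
    obtain k where k: "n \<le> k" "t \<in> {lo (f k)<..<hi (f k)}"
      using t by (rule deepD)
    have "ereal (16 * tol k) < a"
      using n[OF k(1)] r(2) by (intro le_less_trans[OF _ r(2)]) simp
    then show "\<forall>\<^sub>F \<delta> in at_right 0. osc ?g (?U \<delta>) < a"
      using small[OF k(2)] by (auto elim!: eventually_mono)
  qed
qed

section \<open>Surviving core times and the set of positive portions\<close>

definition residue :: "nat \<Rightarrow> real set" where
  "residue p = core (f p) - (\<Union>j\<in>{p<..}. zone (f j))"

lemma sets_residue: "residue p \<in> sets lebesgue"
  using node_core(1)[of p] unfolding residue_def
  by (intro sets.Diff sets.countable_UN') (auto intro: fmeasurableD lmeasurable_compact)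

lemma emeasure_residue_pos: "0 < emeasure lebesgue (residue p)"
  unfolding residue_def
proof (rule emeasure_diff_small_intervals_pos)
  show "compact (core (f p))" "0 < measure lebesgue (core (f p))"
    by (fact node_core)+
  fix j assume "j \<in> {p<..}"
  then show "(mhi (f j) - mlo (f j)) * 2 ^ Suc j \<le> measure lebesgue (core (f p))"
    using link[of j] by (simp add: linked_def)
  show "mlo (f j) \<le> mhi (f j)" using node_bounds[of j] by linarith
qed simp

lemma residue_subset: "residue p \<subseteq> {lo (f p)<..<hi (f p)}"
  using node_core(2) by (auto simp: residue_def)

text \<open>A time \<open>y\<close> of \<open>U \<inter> residue q\<close> lies in some
  \<open>B i\<close> inside \<open>U\<close>. When the pair \<open>(q, i)\<close> is served,
  \<open>y\<close> is still an uncovered core time, so the new zone must lie in \<open>B i\<close>,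
  and with it the whole residue of a node of index above \<open>q\<close>.\<close>

lemma deeper_residue:
  assumes U: "open U" and pos: "0 < emeasure lebesgue (U \<inter> residue p)"
  shows "\<exists>q\<ge>n. 0 < emeasure lebesgue (U \<inter> residue q)"
proof (induction n)
  case 0
  then show ?case using pos by blast
next
  case (Suc n)
  then obtain q where q: "n \<le> q" "0 < emeasure lebesgue (U \<inter> residue q)" by blast
  then obtain y where y: "y \<in> U" "y \<in> residue q"
    by (metis Int_iff emeasure_empty equals0I less_irrefl)
  obtain i where i: "y \<in> B i" "B i \<subseteq> U"
    using base[OF U y(1)] by blast
  define m where "m = prod_encode (q, i)"
  have "q \<le> m" by (simp add: m_def le_prod_encode_1)
  have "y \<in> core (f q) \<inter> B i - (\<Union>j\<in>{q<..m}. zone (f j))"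
    using y i by (auto simp: residue_def)
  then have "core (f q) \<inter> B i - (\<Union>j\<in>{q<..m}. zone (f j)) \<noteq> {}"
    by blast
  then have "zone (f (Suc m)) \<subseteq> B i"
    using refine[of m] by (simp add: refines_def m_def)
  then have "U \<inter> residue (Suc m) = residue (Suc m)"
    using i(2) residue_subset[of "Suc m"] node_bounds[of "Suc m"] by force
  then show ?case
    using emeasure_residue_pos[of "Suc m"] q(1) \<open>q \<le> m\<close> by (intro exI[of _ "Suc m"]) simp
qed

text \<open>The union lets every later arc contribute. The support, unlike the closure, omits points
  near which the survivors have measure zero.\<close>

definition F :: "real set" where "F = lebesgue_support (\<Union>p. residue p)"

lemma sets_Union_residue: "(\<Union>p. residue p) \<in> sets lebesgue"
  using sets_residue by blast

lemma F_meets_deep_levels: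
  assumes U: "open U" "U \<inter> F \<noteq> {}"
  shows "\<exists>k\<ge>n. U \<inter> F \<inter> {lo (f k)<..<hi (f k)} \<noteq> {}"
proof -
  have "0 < emeasure lebesgue (U \<inter> (\<Union>p. residue p))"
    using U by (auto simp: F_def lebesgue_support_def)
  have "\<exists>p. 0 < emeasure lebesgue (U \<inter> residue p)"
  proof (rule ccontr)
    assume "\<nexists>p. 0 < emeasure lebesgue (U \<inter> residue p)"
    then have "(\<Union>p. U \<inter> residue p) \<in> null_sets lebesgue"
      using sets_residue U(1) by (intro null_sets_UN null_setsI) (auto simp: borel_open)
    then show False
      using \<open>0 < emeasure lebesgue (U \<inter> (\<Union>p. residue p))\<close> by (auto dest: null_setsD1)
  qed
  then obtain q where q: "n \<le> q" "0 < emeasure lebesgue (U \<inter> residue q)"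
    using deeper_residue[OF U(1)] by blast
  \<comment> \<open>Positive measure of \<open>U \<inter> residue q\<close> is not yet a point of
    \<open>F\<close>; only a null part of the residue can lie outside the support.\<close>
  have "residue q - F \<in> sets lebesgue"
    using sets_residue closed_lebesgue_support unfolding F_def by (intro sets.Diff) (auto simp: borel_closed)
  moreover have "residue q - F \<subseteq> (\<Union>p. residue p) - F" by blast
  ultimately have "residue q - F \<in> null_sets lebesgue"
    using null_diff_lebesgue_support[OF sets_Union_residue] unfolding F_def[symmetric]
    by (metis null_sets_subset)
  then have "emeasure lebesgue (U \<inter> residue q - (residue q - F)) = emeasure lebesgue (U \<inter> residue q)"
    using sets_residue U(1) by (intro emeasure_Diff_null_set) (auto simp: borel_open)
  moreover have "U \<inter> residue q - (residue q - F) = U \<inter> residue q \<inter> F" by blast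
  ultimately have "U \<inter> residue q \<inter> F \<noteq> {}"
    using q(2) by auto
  then show ?thesis
    using residue_subset q(1) by blast
qed

lemma F_subset: "F \<subseteq> {0..1}"
proof
  fix t assume t: "t \<in> F"
  have "residue p \<subseteq> {0..1}" for p
    using residue_subset[of p] node_bounds[of p] by fastforce
  then have empty: "- {0..1} \<inter> (\<Union>p. residue p) = {}" by blast
  show "t \<in> {0..1}"
  proof (rule ccontr)
    assume "t \<notin> {0..1}"
    then have "0 < emeasure lebesgue (- {0..1} \<inter> (\<Union>p. residue p))"
      using t unfolding F_def lebesgue_support_def by blast
    then show False by (simp add: empty)
  qed
qed

lemma F_nonempty: "F \<noteq> {}"
proof
  assume "F = {}"
  then have "emeasure lebesgue (UNIV \<inter> (\<Union>p. residue p)) = 0"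
    using emeasure_Int_lebesgue_support[OF sets_Union_residue, of UNIV] by (simp add: F_def)
  then have "emeasure lebesgue (residue 0) \<le> 0"
    using emeasure_mono[of "residue 0" "\<Union>p. residue p" lebesgue] sets_Union_residue by auto
  then show False
    using emeasure_residue_pos[of 0] by simp
qed

lemma residual_in_deep: "residual_in F (F \<inter> deep)"
proof -
  define N where "N n = F - (\<Union>k\<in>{n..}. {lo (f k)<..<hi (f k)})" for n
  have "nowhere_dense_in F (N n)" for n
  proof -
    have "closed (- (\<Union>k\<in>{n..}. {lo (f k)<..<hi (f k)}))"
      by (intro closed_Compl open_UN) auto
    then have "closedin (top_of_set F) (N n)"
      unfolding N_def Diff_eq by (rule closedin_closed_Int)
    then have "(top_of_set F) closure_of N n = N n"
      by (simp add: closure_of_closedin)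
    moreover have "(top_of_set F) interior_of N n = {}"
    proof (rule ccontr)
      assume "(top_of_set F) interior_of N n \<noteq> {}"
      then obtain V where "openin (top_of_set F) V" "V \<noteq> {}" "V \<subseteq> N n"
        by (metis openin_interior_of interior_of_subset)
      then obtain U where U: "open U" "F \<inter> U \<noteq> {}" "F \<inter> U \<subseteq> N n"
        by (metis openin_open)
      then obtain k where "n \<le> k" "U \<inter> F \<inter> {lo (f k)<..<hi (f k)} \<noteq> {}"
        using F_meets_deep_levels[of U n] by (auto simp: Int_commute)
      then show False
        using U(3) by (auto simp: N_def)
    qed
    ultimately show ?thesis
      by (auto simp: nowhere_dense_in_def N_def)
  qed
  moreover have "F - F \<inter> deep \<subseteq> \<Union>(range N)"
    by (auto simp: deep_def N_def)
  ultimately have "meager_in F (F - F \<inter> deep)"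
    unfolding meager_in_def by (intro conjI exI[of _ "range N"]) auto
  then show ?thesis
    by (simp add: residual_in_def)
qed

end

subsection \<open>Construction of the sequence\<close>

text \<open>Baire makes \<open>D\<close> dense in \<open>S\<close>. As \<open>D\<close> lies in
  \<open>A\<close> and hence in \<open>W\<close>, intersecting with \<open>W\<close> keeps each
  \<open>G n\<close> dense in \<open>S\<close> even if \<open>S\<close> leaves
  \<open>W\<close>.\<close>

lemma residual_inE:
  fixes S A W :: "'a::euclidean_space set"
  assumes res: "residual_in S (A \<inter> S)" and S: "closed S" and AW: "A \<subseteq> W" and W: "open W"
  obtains G :: "nat \<Rightarrow> 'a set" where "\<And>n. open (G n)" "decseq G" "\<And>n. G n \<subseteq> W"
    "\<And>n U. open U \<Longrightarrow> U \<inter> S \<noteq> {} \<Longrightarrow> U \<inter> S \<inter> G n \<noteq> {}" "S \<inter> (\<Inter>n. G n) \<subseteq> A"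
proof -
  obtain \<N> where \<N>: "countable \<N>" "\<forall>N\<in>\<N>. nowhere_dense_in S N" "S - A \<inter> S \<subseteq> \<Union>\<N>"
    using res unfolding residual_in_def meager_in_def by blast
  define D where "D = S \<inter> (\<Inter>N\<in>\<N>. - closure N)"
  have DA: "D \<subseteq> A"
  proof
    fix x assume x: "x \<in> D"
    have "x \<notin> N" if "N \<in> \<N>" for N
      using x that closure_subset[of N] by (auto simp: D_def)
    then show "x \<in> A"
      using x \<N>(3) by (auto simp: D_def)
  qed
  \<comment> \<open>Inserting \<open>S\<close> keeps the intersection inside \<open>S\<close> even
    when \<open>\<N>\<close> is empty.\<close>
  have "S \<subseteq> closure (\<Inter>(insert S ((\<lambda>N. S \<inter> - closure N) ` \<N>)))"
  proof (rule Baire[OF S])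
    show "countable (insert S ((\<lambda>N. S \<inter> - closure N) ` \<N>))"
      using \<N>(1) by simp
    fix T assume "T \<in> insert S ((\<lambda>N. S \<inter> - closure N) ` \<N>)"
    then consider "T = S" | N where "N \<in> \<N>" "T = S \<inter> - closure N" by blast
    then show "openin (top_of_set S) T \<and> S \<subseteq> closure T"
    proof cases
      case 1
      then show ?thesis by (auto simp: closure_subset)
    next
      case 2
      have "S \<subseteq> closure T"
      proof (rule ccontr)
        assume "\<not> S \<subseteq> closure T"
        then obtain x where x: "x \<in> S" "x \<notin> closure T" by blast
        have "S \<inter> - closure T \<subseteq> S \<inter> closure N"
          using 2 closure_subset[of T] by blast
        then have "S \<inter> - closure T \<subseteq> (top_of_set S) closure_of N"
          using 2(1) \<N>(2) by (simp add: closure_of_subtopology nowhere_dense_in_def inf.absorb2)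
        moreover have "openin (top_of_set S) (S \<inter> - closure T)"
          by (intro openin_open_Int) auto
        ultimately have "x \<in> (top_of_set S) interior_of ((top_of_set S) closure_of N)"
          using x unfolding interior_of_def by blast
        then show False
          using 2(1) \<N>(2) by (simp add: nowhere_dense_in_def)
      qed
      then show ?thesis
        using 2(2) by (auto intro!: openin_open_Int)
    qed
  qed
  moreover have "\<Inter>(insert S ((\<lambda>N. S \<inter> - closure N) ` \<N>)) = D"
    unfolding D_def by blast
  ultimately have SD: "S \<subseteq> closure D" by simp
  \<comment> \<open>The empty set makes the family nonempty, so that it can be enumerated; its
    closure excludes nothing.\<close>
  define e where "e = from_nat_into (insert {} \<N>)"
  have range_e: "range e = insert {} \<N>"
    unfolding e_def using \<N>(1) by (intro range_from_nat_into) auto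
  define G where "G n = W \<inter> (\<Inter>i\<le>n. - closure (e i))" for n
  have DG: "D \<subseteq> G n" for n
  proof -
    have "x \<notin> closure (e i)" if "x \<in> D" for x i
    proof -
      have "e i \<in> insert {} \<N>" using range_e by blast
      then show ?thesis using that by (auto simp: D_def)
    qed
    then show ?thesis
      using DA AW by (auto simp: G_def)
  qed
  show thesis
  proof (rule that)
    show "open (G n)" for n
      unfolding G_def using W by (intro open_Int open_INT) auto
    show "decseq G"
      unfolding decseq_def G_def by force
    show "G n \<subseteq> W" for n
      by (simp add: G_def)
    show "U \<inter> S \<inter> G n \<noteq> {}" if "open U" "U \<inter> S \<noteq> {}" for n U
    proof -
      have "U \<inter> closure D \<noteq> {}"
        using that SD by blast
      then have "U \<inter> D \<noteq> {}"
        using open_Int_closure_eq_empty[OF \<open>open U\<close>] by blast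
      then show ?thesis
        using DG by (auto simp: D_def)
    qed
    show "S \<inter> (\<Inter>n. G n) \<subseteq> A"
    proof -
      have "x \<in> D" if x: "x \<in> S" "\<And>n. x \<in> G n" for x
      proof -
        have "x \<notin> closure N" if "N \<in> \<N>" for N
        proof -
          obtain i where "N = e i"
            using range_e \<open>N \<in> \<N>\<close> by (metis insertCI rangeE)
          then show ?thesis using x(2)[of i] by (auto simp: G_def)
        qed
        then show ?thesis using x(1) by (simp add: D_def)
      qed
      then show ?thesis using DA by blast
    qed
  qed
qed

text \<open>The first arc has nothing to be grafted into and is extended by two straight tails, slow
  enough to stay in a ball inside \<open>G 0\<close>. Having no ramps, the root has its zone equal
  to its arc.\<close>

lemma exists_root_node:
  fixes S :: "'a::euclidean_space set"
  assumes S: "every_portion_pos_cone_width S" "S \<noteq> {}"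
    and G: "\<And>n. open (G n)" "\<And>n U. open U \<Longrightarrow> U \<inter> S \<noteq> {} \<Longrightarrow> U \<inter> S \<inter> G n \<noteq> {}"
  obtains r w where "node_ok S G 0 r" "mlo r = lo r" "mhi r = hi r" "w \<noteq> 0"
    "0-lipschitz_on {0..lo r} (\<lambda>t. crv r t - t *\<^sub>R w)" "0-lipschitz_on {hi r..1} (\<lambda>t. crv r t - t *\<^sub>R w)"
    "crv r ` ({0..1} - {lo r<..<hi r}) \<subseteq> G 0"
proof -
  have "\<forall>W. open W \<and> W \<subseteq> UNIV \<and> W \<inter> S \<noteq> {} \<longrightarrow> (\<exists>u\<in>UNIV. admits_direction S W u)"
    by (auto elim: portion_admits_direction[OF S(1)])
  \<comment> \<open>Tolerance 1 is as good as any: no earlier direction has to be respected.\<close>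
  then obtain v0 V0 where st: "stable_direction S V0 v0 1"
    using exists_stable_direction[of 1 UNIV S UNIV] S(2) by (metis Int_UNIV_left open_UNIV zero_less_one)
  then have "open V0" "V0 \<inter> S \<noteq> {}"
    by (auto simp: stable_direction_def)
  then obtain z where z: "z \<in> V0" "z \<in> S" "z \<in> G 0"
    using G(2)[of V0 0] by blast
  obtain \<sigma> where \<sigma>: "0 < \<sigma>" "ball z \<sigma> \<subseteq> G 0"
    using openE[OF G(1)[of 0] z(3)] by blast
  define \<epsilon> where "\<epsilon> = tol 0"
  have eps: "0 < \<epsilon>" "\<epsilon> \<le> 1 / 32" by (auto simp: \<epsilon>_def tol_def)
  have \<sigma>4: "0 < \<sigma> / 4" and \<delta>: "0 < min (\<sigma> / 4) (1 / 4)"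
    using \<sigma>(1) by auto
  obtain V' v' \<alpha> len P where arc: "V' \<subseteq> ball z (\<sigma> / 4)" "stable_direction S V' v' \<epsilon>"
    "norm (v' - v0) \<le> 1 + \<epsilon>" "0 < len" "len \<le> min (\<sigma> / 4) (1 / 4)"
    "\<forall>t\<in>{0..len}. \<alpha> differentiable (at t within {0..len})"
    "(1 - \<epsilon>)-lipschitz_on {0..len} \<alpha>" "(4 * \<epsilon>)-lipschitz_on {0..len} (\<lambda>t. \<alpha> t - t *\<^sub>R v')"
    "compact P" "P \<subseteq> {0<..<len}" "0 < measure lebesgue P" "\<alpha> ` P \<subseteq> V' \<inter> S"
    "cball (\<alpha> 0) len \<subseteq> G 0"
    by (rule exists_arc_nearby[OF st z(1,2) \<sigma>4 eps \<delta> G(1) G(2)])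
  define l r where "l = (1 / 4 :: real)" and "r = l + len"
  have lr: "0 < l" "l < r" "r < 1" "r - l = len"
    using arc(4,5) by (auto simp: l_def r_def)
  \<comment> \<open>The arc stays within \<open>\<sigma> / 2\<close> of \<open>z\<close>; each tail
    lasts less than one unit of time and adds at most \<open>\<sigma> / 4\<close>.\<close>
  define w where "w = min (\<sigma> / 4) 1 *\<^sub>R v'"
  have "norm v' = 1"
    using arc(2) by (simp add: stable_direction_def)
  then have w: "w \<noteq> 0" "norm w \<le> \<sigma> / 4" "norm w \<le> 1"
    using \<sigma>(1) by (auto simp: w_def)
  define g where "g t = (if t < l then \<alpha> 0 + (t - l) *\<^sub>R w else if t \<le> r then \<alpha> (t - l) else \<alpha> len + (t - r) *\<^sub>R w)" for t
  have g_left: "g t = \<alpha> 0 + (t - l) *\<^sub>R w" if "t \<le> l" for t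
    using that lr by (cases "t = l") (auto simp: g_def)
  have g_mid: "g t = \<alpha> (t - l)" if "t \<in> {l..r}" for t
    using that by (auto simp: g_def)
  have g_right: "g t = \<alpha> len + (t - r) *\<^sub>R w" if "r \<le> t" for t
    using that lr by (cases "t = r") (auto simp: g_def)
  have left: "0-lipschitz_on {0..l} (\<lambda>t. g t - t *\<^sub>R w)"
    by (rule lipschitz_on_transform[OF lipschitz_on_constant[of _ "\<alpha> 0 - l *\<^sub>R w"]])
      (simp add: g_left scaleR_diff_left)
  have right: "0-lipschitz_on {r..1} (\<lambda>t. g t - t *\<^sub>R w)"
    by (rule lipschitz_on_transform[OF lipschitz_on_constant[of _ "\<alpha> len - r *\<^sub>R w"]])
      (simp add: g_right scaleR_diff_left)
  have mid: "(1 - \<epsilon>)-lipschitz_on {l..r} g"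
    by (rule lipschitz_on_transform[OF lipschitz_on_translate[OF arc(7), of l, folded r_def] g_mid])
  have drift: "(4 * \<epsilon>)-lipschitz_on {l..r} (\<lambda>t. g t - t *\<^sub>R v')"
    by (rule lipschitz_on_transform[OF lipschitz_on_translate_drift[OF arc(8), of l, folded r_def]])
      (simp add: g_mid)
  have "1-lipschitz_on {0..l} g" "1-lipschitz_on {r..1} g"
    using lipschitz_on_change_drift[OF left, of 0] lipschitz_on_change_drift[OF right, of 0] w(3)
    by (auto intro: lipschitz_on_le)
  moreover have "1-lipschitz_on {l..r} g"
    using eps by (intro lipschitz_on_le[OF mid]) auto
  ultimately have lip1: "1-lipschitz_on {0..1} g"
    using lipschitz_on_join by blast
  obtain c where c: "c \<in> P"
    using arc(11) by (metis all_not_in_conv less_irrefl measure_empty)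
  have "c \<in> {0<..<len}" "\<alpha> c \<in> ball z (\<sigma> / 4)"
    using c arc(1,10,12) by blast+
  then have c': "c \<in> {0..len}" "dist z (\<alpha> c) < \<sigma> / 4"
    by auto
  have near: "dist z (\<alpha> s) < \<sigma> / 2" if "s \<in> {0..len}" for s
  proof -
    have "dist (\<alpha> c) (\<alpha> s) \<le> (1 - \<epsilon>) * dist c s"
      by (rule lipschitz_onD[OF arc(7) c'(1) that])
    also have "\<dots> \<le> 1 * len"
      using that c'(1) eps by (intro mult_mono) (auto simp: dist_real_def)
    finally show ?thesis
      using c'(2) arc(5) dist_triangle[of z "\<alpha> s" "\<alpha> c"] by simp
  qed
  have outside: "g t \<in> G 0" if t: "t \<in> {0..1}" "t \<notin> {l<..<r}" for t
  proof -
    obtain s a where sa: "s \<in> {0..len}" "\<bar>a\<bar> \<le> 1" "g t = \<alpha> s + a *\<^sub>R w"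
    proof (cases "t \<le> l")
      case True
      then show thesis
        using that[of 0 "t - l"] t lr arc(4) g_left by auto
    next
      case False
      then show thesis
        using that[of len "t - r"] t lr arc(4) g_right by auto
    qed
    have "norm (a *\<^sub>R w) \<le> 1 * (\<sigma> / 4)"
      using sa(2) w(2) by (simp only: norm_scaleR real_norm_def) (intro mult_mono, auto)
    then have "dist (\<alpha> s) (g t) \<le> \<sigma> / 4"
      by (simp add: sa(3) dist_norm)
    then have "dist z (g t) < \<sigma>"
      using near[OF sa(1)] dist_triangle[of z "g t" "\<alpha> s"] \<sigma>(1) by linarith
    then show ?thesis
      using \<sigma>(2) by auto
  qed
  define R where "R = \<lparr>crv = g, lo = l, hi = r, mlo = l, mhi = r, vel = v', reg = V', core = (+) l ` P\<rparr>"
  have R: "crv R = g" "lo R = l" "hi R = r" "mlo R = l" "mhi R = r" "vel R = v'" "reg R = V'" "core R = (+) l ` P"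
    by (simp_all add: R_def)
  have "node_ok S G 0 R"
    unfolding node_ok_def R \<epsilon>_def[symmetric]
  proof (intro conjI)
    show "0 < l" "l \<le> l" "l < r" "r \<le> r" "r < 1" using lr by auto
    show "r - l \<le> (1 / 2) ^ 0" using lr by simp
    show "compact ((+) l ` P)" using arc(9) by (rule compact_translation)
    show "(+) l ` P \<subseteq> {l<..<r}" using arc(10) by (auto simp: r_def)
    show "0 < measure lebesgue ((+) l ` P)" using arc(11) by (simp add: measure_translation)
    have "g (l + s) = \<alpha> s" if "s \<in> P" for s
      using that arc(10) by (subst g_mid) (auto simp: r_def)
    then show "g ` (+) l ` P \<subseteq> V' \<inter> S" using arc(12) by auto
    show "stable_direction S V' v' \<epsilon>" by fact
    show "cball (g l) (r - l) \<subseteq> G 0" using arc(13) lr by (simp add: g_mid)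
    show "1-lipschitz_on {0..1} g" "(1 - \<epsilon>)-lipschitz_on {l..r} g" "(4 * \<epsilon>)-lipschitz_on {l..r} (\<lambda>t. g t - t *\<^sub>R v')"
      by fact+
    have "g differentiable (at t within {0..1})" if t: "t \<in> {0..1}" "t \<noteq> l" "t \<noteq> r" for t
    proof -
      consider "t \<in> {..<l}" | "t \<in> {l<..<r}" | "t \<in> {r<..}"
        using t by fastforce
      then show ?thesis
      proof cases
        case 1
        have "(\<lambda>t. \<alpha> 0 + (t - l) *\<^sub>R w) differentiable (at t within {0..1})"
          by (intro differentiable_add differentiable_scaleR derivative_intros)
        then show ?thesis
          by (rule differentiable_transform_open[OF _ _ 1 t(1)]) (auto simp: g_left)
      next
        case 2
        have "(\<lambda>t. \<alpha> (t - l)) differentiable (at t)"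
          using differentiable_translate[OF arc(6)] 2 by (simp add: r_def)
        then show ?thesis
          by (intro differentiable_transform_open[OF differentiable_at_withinI _ 2 t(1)]) (auto simp: g_mid)
      next
        case 3
        have "(\<lambda>t. \<alpha> len + (t - r) *\<^sub>R w) differentiable (at t within {0..1})"
          by (intro differentiable_add differentiable_scaleR derivative_intros)
        then show ?thesis
          by (rule differentiable_transform_open[OF _ _ 3 t(1)]) (auto simp: g_right)
      qed
    qed
    then have "{t\<in>{0..1}. \<not> g differentiable (at t within {0..1})} \<subseteq> {l, r}" by blast
    then show "finite {t\<in>{0..1}. \<not> g differentiable (at t within {0..1})}"
      by (rule finite_subset) simp
  qed
  then show thesis
    using that[of R w] left right outside w(1) by (simp add: R image_subset_iff)
qed

section \<open>Choosing the nodes by recursion\<close>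

lemma refines_cong:
  assumes "\<And>j. j \<le> n \<Longrightarrow> f j = g j"
  shows "refines B f n r = refines B g n r"
proof -
  obtain p i where pi: "prod_decode n = (p, i)" by force
  then have "p \<le> n"
    by (metis le_prod_encode_1 prod_decode_inverse)
  moreover have "(\<Union>j\<in>{p<..n}. zone (f j)) = (\<Union>j\<in>{p<..n}. zone (g j))"
    using assms by auto
  ultimately show ?thesis
    using assms by (simp add: refines_def pi)
qed

lemma linked_cong: "(\<And>j. j < k \<Longrightarrow> f j = g j) \<Longrightarrow> linked f k r = linked g k r"
  by (simp add: linked_def)

lemma exists_node_sequence:
  fixes S :: "'a::euclidean_space set"
  assumes root: "node_ok S G 0 r0"
    and G: "\<And>n. open (G n)" "\<And>n U. open U \<Longrightarrow> U \<inter> S \<noteq> {} \<Longrightarrow> U \<inter> S \<inter> G n \<noteq> {}"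
    and B: "\<And>i. open (B i)"
  obtains f where "f 0 = r0" "\<And>k. node_ok S G k (f k)" "\<And>k. linked f k (f k)" "\<And>n. refines B f n (f (Suc n))"
proof -
  \<comment> \<open>The condition on node \<open>k\<close> looks only at earlier nodes, as the
    congruence lemmas confirm, so well-founded dependent choice applies. At index 0 it just fixes
    the root, for which \<open>linked\<close> is vacuous.\<close>
  define Q where "Q f k r \<longleftrightarrow> (if k = 0 then r = r0 else
      node_ok S G k r \<and> linked f k r \<and> refines B f (k - 1) r)" for f k r
  have "\<exists>f. \<forall>k. Q f k (f k)"
  proof (rule dependent_wf_choice[OF wf_less_than])
    fix f g k r assume eq: "\<And>z. (z, k) \<in> less_than \<Longrightarrow> (f z :: 'a node) = g z"
    show "Q f k r = Q g k r"
    proof (cases k)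
      case (Suc n)
      then show ?thesis
        using linked_cong[of k f g r] refines_cong[of n f g B r] eq by (simp add: Q_def)
    qed (simp add: Q_def)
  next
    fix k f assume hist: "\<And>j. (j, k) \<in> less_than \<Longrightarrow> Q f j (f j)"
    show "\<exists>r. Q f k r"
    proof (cases k)
      case 0
      then show ?thesis by (simp add: Q_def)
    next
      case (Suc n)
      have node: "node_ok S G j (f j)" and link: "linked f j (f j)" if "j \<le> n" for j
        using hist[of j] that root Suc by (cases "j = 0"; simp add: Q_def linked_def)+
      have ref: "refines B f j (f (Suc j))" if "j < n" for j
        using hist[of "Suc j"] that Suc by (simp add: Q_def)
      have "\<exists>r. node_ok S G (Suc n) r \<and> linked f (Suc n) r \<and> refines B f n r"
        by (rule exists_next_node[OF G B node link ref])
      then show ?thesis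
        using Suc by (simp add: Q_def)
    qed
  qed
  then obtain f where f: "\<And>k. Q f k (f k)" by blast
  show thesis
  proof (rule that)
    show "f 0 = r0" using f[of 0] by (simp add: Q_def)
    show "node_ok S G k (f k)" for k
      using f[of k] root by (cases "k = 0") (auto simp: Q_def)
    show "linked f k (f k)" for k
      using f[of k] by (cases "k = 0") (auto simp: Q_def linked_def)
    show "refines B f n (f (Suc n))" for n
      using f[of "Suc n"] by (simp add: Q_def)
  qed
qed

theorem theorem2p11:
  fixes \<F> \<A> :: "'a::euclidean_space set"
  assumes "\<F> \<subseteq> cbox 0 One" and "\<F> \<noteq> {}" and "closed \<F>"
    and "every_portion_pos_cone_width \<F>"
    and "\<A> \<subseteq> box 0 One" and "analytic_set \<A>"
    and "residual_in \<F> (\<A> \<inter> \<F>)"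
  shows "\<exists>(\<gamma>::real \<Rightarrow> 'a) E F.
           lipschitz_curve 0 1 \<gamma> \<and> 1-lipschitz_on {0..1} \<gamma> \<and> \<gamma> ` {0..1} \<subseteq> box 0 One
         \<and> E \<subseteq> F \<and> F \<subseteq> {0..1}
         \<and> F \<noteq> {} \<and> closed F \<and> every_portion_pos_measure F
         \<and> residual_in F E
         \<and> (\<forall>t\<in>E. \<exists>v. (\<gamma> has_vector_derivative v) (at t within {0..1}) \<and> norm v = 1)
         \<and> (\<forall>t\<in>E. ((\<lambda>\<delta>. osc (\<lambda>s. vector_derivative \<gamma> (at s within {0..1}))
                              ({t-\<delta>..t+\<delta>} \<inter> {0..1})) \<longlongrightarrow> 0) (at_right 0))
         \<and> \<gamma> ` E \<subseteq> \<A>"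
proof -
  obtain G :: "nat \<Rightarrow> 'a set" where G: "\<And>n. open (G n)" "decseq G" "\<And>n. G n \<subseteq> box 0 One"
    "\<And>n U. open U \<Longrightarrow> U \<inter> \<F> \<noteq> {} \<Longrightarrow> U \<inter> \<F> \<inter> G n \<noteq> {}" "\<F> \<inter> (\<Inter>n. G n) \<subseteq> \<A>"
    using residual_inE[OF assms(7,3,5) open_box] by blast
  obtain r0 w where root: "node_ok \<F> G 0 r0" "mlo r0 = lo r0" "mhi r0 = hi r0" "w \<noteq> 0"
    "0-lipschitz_on {0..lo r0} (\<lambda>t. crv r0 t - t *\<^sub>R w)" "0-lipschitz_on {hi r0..1} (\<lambda>t. crv r0 t - t *\<^sub>R w)"
    and out: "crv r0 ` ({0..1} - {lo r0<..<hi r0}) \<subseteq> G 0"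
    by (rule exists_root_node[OF assms(4,2), where G = G, OF G(1,4)])
  obtain \<B> :: "real set set" where \<B>: "countable \<B>" "topological_basis \<B>"
    using ex_countable_basis by blast
  define B where "B = from_nat_into \<B>"
  have "\<B> \<noteq> {}"
    using topological_basisE[OF \<B>(2) open_UNIV UNIV_I] by blast
  then have range_B: "range B = \<B>"
    unfolding B_def using \<B>(1) by (intro range_from_nat_into)
  have "open (B i)" for i
    using range_B topological_basis_open[OF \<B>(2)] by blast
  then obtain f where f: "f 0 = r0" "\<And>k. node_ok \<F> G k (f k)" "\<And>k. linked f k (f k)" "\<And>n. refines B f n (f (Suc n))"
    using exists_node_sequence[OF root(1) G(1,4)] by blast
  interpret node_sequence \<F> G B f
  proof
    fix U :: "real set" and x assume "open U" "x \<in> U"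
    then obtain B' where "B' \<in> \<B>" "x \<in> B'" "B' \<subseteq> U"
      using topological_basisE[OF \<B>(2)] by blast
    then show "\<exists>i. x \<in> B i \<and> B i \<subseteq> U"
      using range_B by blast
  qed (use f G assms(3) in auto)
  have "\<gamma> t \<in> box 0 One" if "t \<in> {0..1}" for t
  proof (cases "t \<in> {lo r0<..<hi r0}")
    case True
    then show ?thesis
      using \<gamma>_mem_G[of t 0] G(3) f(1) by auto
  next
    case False
    then have "\<gamma> t = crv r0 t"
      using \<gamma>_eq_outside[of t] f(1) root(2,3) by simp
    then show ?thesis
      using out that False G(3)[of 0] by (simp add: image_subset_iff subset_iff)
  qed
  then have "\<gamma> ` {0..1} \<subseteq> box 0 One" by blast
  moreover have "lipschitz_curve 0 1 \<gamma>"
    using lipschitz_curve_\<gamma>[of w] root f(1) by simp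
  moreover have "\<forall>t\<in>F \<inter> deep. \<exists>v. (\<gamma> has_vector_derivative v) (at t within {0..1}) \<and> norm v = 1"
    using deep_has_vector_derivative has_vector_derivative_at_within by (metis IntD2)
  moreover have "\<gamma> ` (F \<inter> deep) \<subseteq> \<A>"
    using deep_\<gamma>_mem_S deep_\<gamma>_mem_G G(5) by blast
  moreover have "closed F" "every_portion_pos_measure F"
    using closed_lebesgue_support every_portion_pos_measure_lebesgue_support[OF sets_Union_residue]
    by (simp_all add: F_def)
  ultimately show ?thesis
    using \<gamma>_lipschitz F_subset F_nonempty residual_in_deep deep_osc_tendsto_0
    by (intro exI[of _ \<gamma>] exI[of _ "F \<inter> deep"] exI[of _ F] conjI) auto
qed

end
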